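(* Let $p \ge 2$ be an integer. Then the following statements hold. (i) If $p$ is even then there exists a positive integer $K_p$ such that for all integers $k \ge K_p$, $$\mathcal{C}_{\mathrm{imp}}(k, p) = \mathcal{C}_{\mathrm{imp}}(\infty, p).$$ (ii) If $p$ is odd then there exists a positive integer $k_p$ such that for all integers $k > k_p$, $$\frac{1}{k-1} \le \mathcal{C}_{\mathrm{imp}}(\infty, p-1) - \mathcal{C}_{\mathrm{imp}}(k, p) \le \frac{1}{k-k_p}.$$
   Context: A linear multistep method (LM method) with $k$ steps computes $u_n = \sum_{j=1}^{k} \alpha_j u_{n-j} + h \sum_{j=0}^k \beta_j f(u_{n-j})$ and is identified with its real coefficients $(\alpha_j)_{j=1}^k$, $(\beta_j)_{j=0}^k$ (no requirement that $\alpha_k$ or $\beta_k$ be non-zero). In the class of implicit methods, $\beta_0$ is unrestricted (the value $\beta_0=0$ is allowed). With the convention $0^0=1$, a method has order $p$ if $\sum_{j=1}^{k}\alpha_j=1$ and $\sum_{j=1}^{k}(j^m\alpha_j - m j^{m-1}\beta_j) - m\,0^{m-1}\beta_0=0$ for all $1\le m\le p$. The SSP coefficient of a method is $\mathcal{C}=\min\{\alpha_j/\beta_j : 1\le j\le k,\ \beta_j\ne 0\}$ (with $\min\emptyset=+\infty$) if $\alpha_j\ge 0$ for $1\le j\le k$ and $\beta_j\ge 0$ for $0\le j\le k$, and $\mathcal{C}=0$ otherwise. $\mathcal{C}_{\mathrm{imp}}(k,p)$ is the supremum of $\mathcal{C}$ over all implicit $k$-step LM methods of order $p$, taken to be $0$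 if there are no such methods. For $p\ge 2$ it is non-decreasing in $k$ and bounded, and $\mathcal{C}_{\mathrm{imp}}(\infty,p) := \lim_{k\to\infty}\mathcal{C}_{\mathrm{imp}}(k,p)$. *)

theory Defs
  imports "HOL-Analysis.Analysis"
begin

text \<open>
  A \<open>k\<close>-step linear multistep method is given by two coefficient functions \<open>\<alpha>, \<beta> :: nat \<Rightarrow> real\<close>,
  of which only the values \<open>\<alpha> j\<close> for \<open>1 \<le> j \<le> k\<close> and \<open>\<beta> j\<close> for \<open>0 \<le> j \<le> k\<close> are used. No
  definition below depends on the other values, so they do not affect any supremum.
\<close>

text \<open>In \<open>0 ^ (m - 1)\<close> the library's \<open>0 ^ 0 = 1\<close> is the intended convention. The conditions
  for a given \<open>p\<close> are cumulative: a method of order \<open>p + 1\<close> also has order \<open>p\<close>.\<close>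

definition lm_order :: "nat \<Rightarrow> nat \<Rightarrow> (nat \<Rightarrow> real) \<Rightarrow> (nat \<Rightarrow> real) \<Rightarrow> bool" where
  "lm_order k p \<alpha> \<beta> \<longleftrightarrow>
     (\<Sum>j=1..k. \<alpha> j) = 1 \<and>
     (\<forall>m. 1 \<le> m \<and> m \<le> p \<longrightarrow>
        (\<Sum>j=1..k. real j ^ m * \<alpha> j - real m * real j ^ (m - 1) * \<beta> j)
          - real m * 0 ^ (m - 1) * \<beta> 0 = 0)"

definition ssp_coeff :: "nat \<Rightarrow> (nat \<Rightarrow> real) \<Rightarrow> (nat \<Rightarrow> real) \<Rightarrow> ereal" where
  "ssp_coeff k \<alpha> \<beta> =
     (if (\<forall>j\<in>{1..k}. 0 \<le> \<alpha> j) \<and> (\<forall>j\<in>{0..k}. 0 \<le> \<beta> j)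
      then (if {j \<in> {1..k}. \<beta> j \<noteq> 0} = {} then \<infinity>
            else Min ((\<lambda>j. ereal (\<alpha> j / \<beta> j)) ` {j \<in> {1..k}. \<beta> j \<noteq> 0}))
      else 0)"

text \<open>The case distinction is needed because \<open>Sup {} = -\<infinity>\<close> in \<^typ>\<open>ereal\<close>.\<close>

definition C_imp :: "nat \<Rightarrow> nat \<Rightarrow> ereal" where
  "C_imp k p =
     (if \<exists>\<alpha> \<beta>. lm_order k p \<alpha> \<beta>
      then Sup {ssp_coeff k \<alpha> \<beta> | \<alpha> \<beta>. lm_order k p \<alpha> \<beta>}
      else 0)"

definition C_imp_inf :: "nat \<Rightarrow> ereal" where
  "C_imp_inf p = lim (\<lambda>k. C_imp k p)"

end

theory Submission
  imports Defs
begin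

text \<open>
  For a polynomial \<open>P\<close> of degree at most \<open>p\<close>, a method of order \<open>p\<close> satisfies
  \<open>P(0) = \<Sum>(\<alpha>\<^sub>j - c\<beta>\<^sub>j) P(j) + \<Sum>\<beta>\<^sub>j (cP(j) - P'(j)) - \<beta>\<^sub>0 P'(0)\<close>. Hence, by separation of convex cones in
  the space of moment vectors, the optimal coefficient \<open>c\<close> for \<open>k \<rightarrow> \<infinity>\<close> comes with a certificate: a
  nonzero polynomial \<open>Q\<close> with \<open>Q(0) = 0\<close>, \<open>Q'(0) \<le> 0\<close>, and \<open>Q(j) \<ge> 0\<close>, \<open>Q'(j) \<le> cQ(j)\<close> for all
  \<open>j \<ge> 1\<close>. A certificate of odd degree can be divided by a linear factor with a nonpositive root,
  and any certificate can be multiplied by \<open>(x - a)\<^sup>2 + 4/c\<^sup>2\<close> for large \<open>a\<close>, so for even \<open>p\<close> there is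
  one of degree exactly \<open>p\<close>. Tested against nearly optimal methods, it shows that no \<open>p\<close>-th moment
  escapes to infinity, so by compactness the optimum is attained with finitely many steps.

  For odd \<open>p\<close>, take \<open>Q\<close> and an optimal \<open>K\<close>-step method for \<open>p - 1\<close>. The polynomial \<open>(k - x) Q\<close> bounds
  the coefficient by \<open>c - 1/(k - 1)\<close>. Conversely, applying the method to
  \<open>(P - P(k))/(k - x)\<close> gives a method of order \<open>p\<close> with coefficient \<open>c - 1/(k - K)\<close>; the weight it puts on
  the node \<open>k\<close> has for large \<open>k\<close> the opposite sign of the \<open>p\<close>-th order defect of the method, and
  this defect is negative, again by duality.
\<close>

subsection \<open>Methods as functionals on polynomials\<close>

text \<open>The new value sits at \<open>x = 0\<close> and the value \<open>j\<close> steps back at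
  \<open>x = j\<close>. The axis thus runs against time, whence the minus sign at the
  derivatives.\<close>

definition lm_functional :: "nat \<Rightarrow> (nat \<Rightarrow> real) \<Rightarrow> (nat \<Rightarrow> real) \<Rightarrow> real poly \<Rightarrow> real" where
  "lm_functional k \<alpha> \<beta> P =
     (\<Sum>j=1..k. \<alpha> j * poly P (real j) - \<beta> j * poly (pderiv P) (real j)) - \<beta> 0 * poly (pderiv P) 0"

lemma lm_functional_0 [simp]: "lm_functional k \<alpha> \<beta> 0 = 0"
  by (simp add: lm_functional_def)

lemma lm_functional_add:
  "lm_functional k \<alpha> \<beta> (P + Q) = lm_functional k \<alpha> \<beta> P + lm_functional k \<alpha> \<beta> Q"
  by (simp add: lm_functional_def pderiv_add sum.distrib sum_subtractf algebra_simps)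

lemma lm_functional_smult:
  "lm_functional k \<alpha> \<beta> (smult a P) = a * lm_functional k \<alpha> \<beta> P"
  by (simp add: lm_functional_def pderiv_smult sum_distrib_left algebra_simps)

lemma lm_functional_sum:
  "lm_functional k \<alpha> \<beta> (\<Sum>i\<in>A. f i) = (\<Sum>i\<in>A. lm_functional k \<alpha> \<beta> (f i))"
  by (induction A rule: infinite_finite_induct) (simp_all add: lm_functional_add)

lemma lm_functional_monom:
  "lm_functional k \<alpha> \<beta> (monom 1 m) =
     (\<Sum>j=1..k. real j ^ m * \<alpha> j - real m * real j ^ (m - 1) * \<beta> j) - real m * 0 ^ (m - 1) * \<beta> 0"
  by (simp add: lm_functional_def pderiv_monom poly_monom algebra_simps)

lemma poly_eq_sum_monom:
  fixes P :: "real poly"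
  assumes "degree P \<le> p"
  shows "P = (\<Sum>m\<le>p. smult (coeff P m) (monom 1 m))"
  using poly_as_sum_of_monoms'[OF assms] by (simp add: smult_monom eq_commute)

lemma lm_functional_expand:
  assumes "degree P \<le> p"
  shows "lm_functional k \<alpha> \<beta> P = (\<Sum>m\<le>p. coeff P m * lm_functional k \<alpha> \<beta> (monom 1 m))"
  by (subst poly_eq_sum_monom[OF assms]) (simp only: lm_functional_sum lm_functional_smult)

lemma lm_order_iff_monom:
  "lm_order k p \<alpha> \<beta> \<longleftrightarrow> (\<forall>m\<le>p. lm_functional k \<alpha> \<beta> (monom 1 m) = 0 ^ m)"
proof -
  have "(\<forall>m\<le>p. lm_functional k \<alpha> \<beta> (monom 1 m) = 0 ^ m) \<longleftrightarrow>
    lm_functional k \<alpha> \<beta> (monom 1 0) = 1 \<and>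
    (\<forall>m. 1 \<le> m \<and> m \<le> p \<longrightarrow> lm_functional k \<alpha> \<beta> (monom 1 m) = 0)"
    (is "?A \<longleftrightarrow> ?B")
  proof
    assume ?A then show ?B by (auto simp: power_0_left)
  next
    assume ?B then show ?A
      by (simp add: power_0_left Suc_le_eq)
  qed
  then show ?thesis
    unfolding lm_order_def lm_functional_monom by simp
qed

text \<open>The order conditions are exactness on the monomials up to degree \<open>p\<close>;
  linearity extends this to all polynomials, so certificates can be inserted directly.\<close>

lemma lm_order_iff:
  "lm_order k p \<alpha> \<beta> \<longleftrightarrow> (\<forall>P. degree P \<le> p \<longrightarrow> lm_functional k \<alpha> \<beta> P = poly P 0)"
proof
  assume A: "lm_order k p \<alpha> \<beta>"
  show "\<forall>P. degree P \<le> p \<longrightarrow> lm_functional k \<alpha> \<beta> P = poly P 0"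
  proof (intro allI impI)
    fix P :: "real poly" assume d: "degree P \<le> p"
    have "lm_functional k \<alpha> \<beta> P = (\<Sum>m\<le>p. coeff P m * 0 ^ m)"
      using A unfolding lm_functional_expand[OF d] lm_order_iff_monom by simp
    also have "\<dots> = coeff P 0"
      by (subst sum.remove[of _ 0]) (auto simp: power_0_left)
    finally show "lm_functional k \<alpha> \<beta> P = poly P 0" by (simp add: poly_0_coeff_0)
  qed
next
  assume A: "\<forall>P. degree P \<le> p \<longrightarrow> lm_functional k \<alpha> \<beta> P = poly P 0"
  show "lm_order k p \<alpha> \<beta>"
    unfolding lm_order_iff_monom using A by (simp add: degree_monom_eq poly_monom)
qed

text \<open>For \<open>c > 0\<close> this says that the SSP coefficient is at least
  \<open>c\<close>, with the quotients cleared. For fixed \<open>c\<close> it is linear and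
  homogeneous, so its solutions form a convex cone.\<close>

definition ssp_nonneg :: "real \<Rightarrow> nat \<Rightarrow> (nat \<Rightarrow> real) \<Rightarrow> (nat \<Rightarrow> real) \<Rightarrow> bool" where
  "ssp_nonneg c k \<alpha> \<beta> \<longleftrightarrow> (\<forall>j\<in>{1..k}. 0 \<le> \<alpha> j \<and> c * \<beta> j \<le> \<alpha> j) \<and> (\<forall>j\<in>{0..k}. 0 \<le> \<beta> j)"

definition ssp_feasible :: "nat \<Rightarrow> nat \<Rightarrow> real \<Rightarrow> bool" where
  "ssp_feasible k p c \<longleftrightarrow> (\<exists>\<alpha> \<beta>. lm_order k p \<alpha> \<beta> \<and> ssp_nonneg c k \<alpha> \<beta>)"

section \<open>Padding, weak duality, and an a priori bound on the coefficient\<close>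

lemma lm_functional_extend:
  assumes "k \<le> k'"
  shows "lm_functional k' (\<lambda>j. if j \<le> k then \<alpha> j else 0) (\<lambda>j. if j \<le> k then \<beta> j else 0) P =
    lm_functional k \<alpha> \<beta> P"
proof -
  have "(\<Sum>j=1..k'. (if j \<le> k then \<alpha> j else 0) * poly P (real j)
           - (if j \<le> k then \<beta> j else 0) * poly (pderiv P) (real j)) =
        (\<Sum>j=1..k. \<alpha> j * poly P (real j) - \<beta> j * poly (pderiv P) (real j))"
    by (rule sum.mono_neutral_cong_right) (use assms in auto)
  then show ?thesis by (simp add: lm_functional_def)
qed

lemma ssp_nonneg_extend:
  assumes "ssp_nonneg c k \<alpha> \<beta>"
  shows "ssp_nonneg c k' (\<lambda>j. if j \<le> k then \<alpha> j else 0) (\<lambda>j. if j \<le> k then \<beta> j else 0)"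
  using assms by (auto simp: ssp_nonneg_def)

lemma ssp_feasible_mono_steps:
  assumes "ssp_feasible k p c" "k \<le> k'"
  shows "ssp_feasible k' p c"
proof -
  obtain \<alpha> \<beta> where "lm_order k p \<alpha> \<beta>" "ssp_nonneg c k \<alpha> \<beta>"
    using assms by (auto simp: ssp_feasible_def)
  then have "lm_order k' p (\<lambda>j. if j \<le> k then \<alpha> j else 0) (\<lambda>j. if j \<le> k then \<beta> j else 0)"
    by (simp only: lm_order_iff lm_functional_extend[OF assms(2)])
  then show ?thesis
    unfolding ssp_feasible_def using ssp_nonneg_extend[OF \<open>ssp_nonneg c k \<alpha> \<beta>\<close>] by blast
qed

lemma ssp_nonneg_antimono:
  assumes "ssp_nonneg c k \<alpha> \<beta>" "c' \<le> c"
  shows "ssp_nonneg c' k \<alpha> \<beta>"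
  unfolding ssp_nonneg_def
proof (intro conjI ballI)
  fix j assume j: "j \<in> {1..k}"
  then have "c' * \<beta> j \<le> c * \<beta> j"
    using assms unfolding ssp_nonneg_def by (intro mult_right_mono) auto
  then show "c' * \<beta> j \<le> \<alpha> j" "0 \<le> \<alpha> j" using assms j unfolding ssp_nonneg_def by force+
qed (use assms in \<open>auto simp: ssp_nonneg_def\<close>)

text \<open>Weak duality: \<open>\<alpha> P - \<beta> P'\<close> is regrouped as
  \<open>(\<alpha> - c \<beta>) P + \<beta> (c P - P')\<close>, and the nonnegative term
  \<open>- \<beta> 0 * P'(0)\<close> is dropped. For a certificate every remaining summand is
  nonnegative.\<close>

lemma lm_functional_ge:
  assumes "ssp_nonneg c k \<alpha> \<beta>" "poly (pderiv P) 0 \<le> 0"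
  shows "(\<Sum>j=1..k. (\<alpha> j - c * \<beta> j) * poly P (real j) +
            \<beta> j * (c * poly P (real j) - poly (pderiv P) (real j))) \<le> lm_functional k \<alpha> \<beta> P"
proof -
  have "\<beta> 0 * poly (pderiv P) 0 \<le> 0"
    using assms by (auto simp: ssp_nonneg_def mult_nonneg_nonpos)
  then show ?thesis by (simp add: lm_functional_def algebra_simps)
qed

text \<open>Tested on \<open>x^2\<close>, where the \<open>\<beta> 0\<close> term vanishes. For
  \<open>c > 2\<close> all summands are nonnegative because
  \<open>2 j \<beta> j \<le> j \<alpha> j \<le> j^2 \<alpha> j\<close>; as they add up to 0, each is
  0, which forces \<open>\<alpha> = 0\<close> on all nodes, against the sum 1.\<close>

lemma ssp_feasible_le_2:
  assumes "ssp_feasible k p c" "2 \<le> p"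
  shows "c \<le> 2"
proof (rule ccontr)
  assume c: "\<not> c \<le> 2"
  obtain \<alpha> \<beta> where o: "lm_order k p \<alpha> \<beta>" and nn: "ssp_nonneg c k \<alpha> \<beta>"
    using assms by (auto simp: ssp_feasible_def)
  have "lm_functional k \<alpha> \<beta> (monom 1 2) = 0"
    using o assms(2) by (simp add: lm_order_iff_monom)
  then have e: "(\<Sum>j=1..k. real j ^ 2 * \<alpha> j - 2 * real j * \<beta> j) = 0"
    by (simp add: lm_functional_monom)
  have t: "0 \<le> real j ^ 2 * \<alpha> j - 2 * real j * \<beta> j"
     "0 \<le> \<alpha> j" "0 \<le> \<beta> j" "c * \<beta> j \<le> \<alpha> j"  if j: "j \<in> {1..k}" for j
  proof -
    show *: "0 \<le> \<alpha> j" "0 \<le> \<beta> j" "c * \<beta> j \<le> \<alpha> j" using nn j by (auto simp: ssp_nonneg_def)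
    have "2 * \<beta> j \<le> \<alpha> j"
      using mult_right_mono[of 2 c "\<beta> j"] * c by linarith
    then have "2 * real j * \<beta> j \<le> real j * \<alpha> j"
      using mult_left_mono[of "2 * \<beta> j" "\<alpha> j" "real j"] by simp
    also have "\<dots> \<le> real j ^ 2 * \<alpha> j"
      using j * by (intro mult_right_mono) (auto simp: power2_eq_square)
    finally show "0 \<le> real j ^ 2 * \<alpha> j - 2 * real j * \<beta> j" by simp
  qed
  have z: "\<alpha> j = 0" if j: "j \<in> {1..k}" for j
  proof -
    have e0: "real j ^ 2 * \<alpha> j = 2 * real j * \<beta> j"
      using e sum_nonneg_eq_0_iff[of "{1..k}" "\<lambda>j. real j ^ 2 * \<alpha> j - 2 * real j * \<beta> j"] t(1) j
      by auto
    have "real j * (c * \<beta> j) \<le> real j * \<alpha> j"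
      using t(4)[OF j] by (intro mult_left_mono) auto
    also have "\<dots> \<le> real j ^ 2 * \<alpha> j"
      using j t(2)[OF j] by (intro mult_right_mono) (auto simp: power2_eq_square)
    finally have "(c - 2) * (real j * \<beta> j) \<le> 0" using e0 by (simp add: algebra_simps)
    then have "real j * \<beta> j \<le> 0" using c by (simp add: mult_le_0_iff)
    then have "\<beta> j = 0" using j t(3)[OF j] by (simp add: mult_le_0_iff)
    then show ?thesis using e0 j by simp
  qed
  have "(\<Sum>j=1..k. \<alpha> j) = 1" using o by (simp add: lm_order_def)
  then show False using z by simp
qed

section \<open>From suprema in \<open>ereal\<close> to feasibility of real coefficients\<close>

lemma ssp_coeff_nonneg: "0 \<le> ssp_coeff k \<alpha> \<beta>"
  unfolding ssp_coeff_def by (auto intro!: Min.boundedI simp: zero_ereal_def)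

lemma C_imp_nonneg: "0 \<le> C_imp k p"
proof (cases "\<exists>\<alpha> \<beta>. lm_order k p \<alpha> \<beta>")
  case True
  then obtain \<alpha> \<beta> where "lm_order k p \<alpha> \<beta>" by blast
  then have "ssp_coeff k \<alpha> \<beta> \<le> Sup {ssp_coeff k \<alpha> \<beta> | \<alpha> \<beta>. lm_order k p \<alpha> \<beta>}"
    by (intro Sup_upper) blast
  then have "0 \<le> Sup {ssp_coeff k \<alpha> \<beta> | \<alpha> \<beta>. lm_order k p \<alpha> \<beta>}"
    using ssp_coeff_nonneg order_trans by blast
  then show ?thesis using True by (simp add: C_imp_def)
qed (simp add: C_imp_def)

lemma C_imp_ge:
  assumes "ssp_feasible k p c"
  shows "ereal c \<le> C_imp k p"
proof -
  obtain \<alpha> \<beta> where o: "lm_order k p \<alpha> \<beta>" and nn: "ssp_nonneg c k \<alpha> \<beta>"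
    using assms by (auto simp: ssp_feasible_def)
  have "ereal c \<le> ssp_coeff k \<alpha> \<beta>"
  proof -
    have "c \<le> \<alpha> j / \<beta> j" if "j \<in> {1..k}" "\<beta> j \<noteq> 0" for j
    proof -
      have "0 < \<beta> j" using nn that unfolding ssp_nonneg_def
        by (metis atLeastAtMost_iff order_le_less zero_le)
      then show ?thesis using nn that by (simp add: ssp_nonneg_def field_simps)
    qed
    then show ?thesis using nn
      unfolding ssp_coeff_def by (auto intro!: Min.boundedI simp: ssp_nonneg_def)
  qed
  also have "\<dots> \<le> Sup {ssp_coeff k \<alpha> \<beta> | \<alpha> \<beta>. lm_order k p \<alpha> \<beta>}"
    using o by (intro Sup_upper) blast
  also have "\<dots> = C_imp k p" using o by (auto simp: C_imp_def)
  finally show ?thesis .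
qed

text \<open>Some method has coefficient above \<open>c\<close>; as that coefficient may be infinite,
  a real \<open>c'\<close> is taken in between. \<open>0 \<le> c\<close> excludes both default
  values 0, that of \<open>C_imp\<close> without methods and that of \<open>ssp_coeff\<close> for
  wrong signs.\<close>

lemma C_imp_gtD:
  assumes "ereal c < C_imp k p" "0 \<le> c"
  shows "\<exists>c'>c. ssp_feasible k p c'"
proof -
  have ex: "\<exists>\<alpha> \<beta>. lm_order k p \<alpha> \<beta>"
    using assms by (auto simp: C_imp_def split: if_splits)
  then have "ereal c < Sup {ssp_coeff k \<alpha> \<beta> | \<alpha> \<beta>. lm_order k p \<alpha> \<beta>}"
    using assms by (simp add: C_imp_def)
  then obtain \<alpha> \<beta> where o: "lm_order k p \<alpha> \<beta>" and c: "ereal c < ssp_coeff k \<alpha> \<beta>"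
    unfolding less_Sup_iff by blast
  obtain c' where c': "c < c'" "ereal c' < ssp_coeff k \<alpha> \<beta>"
    using ereal_dense2[OF c] by auto
  have sgn: "\<forall>j\<in>{1..k}. 0 \<le> \<alpha> j" "\<forall>j\<in>{0..k}. 0 \<le> \<beta> j"
    using c assms(2) by (auto simp: ssp_coeff_def split: if_splits)
  have "c' * \<beta> j \<le> \<alpha> j" if j: "j \<in> {1..k}" for j
  proof (cases "\<beta> j = 0")
    case True then show ?thesis using sgn j by auto
  next
    case False
    let ?S = "(\<lambda>j. ereal (\<alpha> j / \<beta> j)) ` {j \<in> {1..k}. \<beta> j \<noteq> 0}"
    have "ssp_coeff k \<alpha> \<beta> = Min ?S"
      using sgn False j by (auto simp: ssp_coeff_def)
    also have "\<dots> \<le> ereal (\<alpha> j / \<beta> j)" using j False by (intro Min_le) auto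
    finally have "ereal c' < ereal (\<alpha> j / \<beta> j)" using c'(2) by (rule less_le_trans[rotated])
    then have "c' < \<alpha> j / \<beta> j" by simp
    moreover have "0 < \<beta> j" using False sgn j by (metis atLeastAtMost_iff order_le_less zero_le)
    ultimately show ?thesis by (simp add: field_simps)
  qed
  then have "ssp_nonneg c' k \<alpha> \<beta>" using sgn by (auto simp: ssp_nonneg_def)
  then show ?thesis using o c' unfolding ssp_feasible_def by blast
qed

lemma ssp_feasible_antimono:
  assumes "ssp_feasible k p c" "c' \<le> c"
  shows "ssp_feasible k p c'"
  using assms ssp_nonneg_antimono unfolding ssp_feasible_def by blast

lemma C_imp_le:
  assumes "0 \<le> b" "\<And>c. ssp_feasible k p c \<Longrightarrow> c \<le> b"
  shows "C_imp k p \<le> ereal b"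
proof (rule ccontr)
  assume "\<not> C_imp k p \<le> ereal b"
  then obtain c where "b < c" "ssp_feasible k p c"
    using C_imp_gtD[of b k p] assms(1) by (meson linorder_not_le)
  then show False using assms(2)[of c] by simp
qed

lemma C_imp_le_2: "2 \<le> p \<Longrightarrow> C_imp k p \<le> 2"
  using C_imp_le[of 2 k p] ssp_feasible_le_2 by auto

text \<open>A real number strictly between the two values avoids a case distinction on the default 0
  and reduces the claim to padding of feasible methods.\<close>

lemma mono_C_imp: "mono (\<lambda>k. C_imp k p)"
proof (rule monoI, rule ccontr)
  fix k k' :: nat assume k: "k \<le> k'" and "\<not> C_imp k p \<le> C_imp k' p"
  then obtain c where c: "C_imp k' p < ereal c" "ereal c < C_imp k p"
    using ereal_dense2 by (meson linorder_not_le)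
  then have "0 \<le> c" using C_imp_nonneg[of k' p]
    by (metis ereal_less_eq(5) order_le_less_trans order_less_imp_le)
  then have "ssp_feasible k' p c"
    using C_imp_gtD[OF c(2)] ssp_feasible_mono_steps[OF _ k] ssp_feasible_antimono
    by (meson order_less_imp_le)
  then show False using C_imp_ge c(1) by (meson linorder_not_le)
qed

lemma C_imp_inf_eq_SUP: "C_imp_inf p = (SUP k. C_imp k p)"
  unfolding C_imp_inf_def by (rule limI[OF LIMSEQ_SUP[OF mono_C_imp]])

subsection \<open>Separation from a convex cone of polynomials\<close>

lemma smult_sum_right:
  fixes f :: "'a \<Rightarrow> real poly"
  shows "smult a (\<Sum>i\<in>A. f i) = (\<Sum>i\<in>A. smult a (f i))"
  by (induction A rule: infinite_finite_induct) (simp_all add: smult_add_right)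

text \<open>Polynomials act here merely as coefficient vectors: the cones to be separated consist of
  moment vectors of linear functionals.\<close>

definition poly_cone :: "real poly set \<Rightarrow> bool" where
  "poly_cone C \<longleftrightarrow> 0 \<in> C \<and> (\<forall>x\<in>C. \<forall>y\<in>C. x + y \<in> C) \<and> (\<forall>x\<in>C. \<forall>a\<ge>0. smult a x \<in> C)"

lemma poly_cone_add: "poly_cone C \<Longrightarrow> x \<in> C \<Longrightarrow> y \<in> C \<Longrightarrow> x + y \<in> C"
  by (simp add: poly_cone_def)

lemma poly_cone_scale: "poly_cone C \<Longrightarrow> x \<in> C \<Longrightarrow> 0 \<le> a \<Longrightarrow> smult a x \<in> C"
  unfolding poly_cone_def by blast

text \<open>One Hahn-Banach step. \<open>\<tau>\<close> is the prospective value at \<open>g\<close>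
  of a functional that is nonnegative on \<open>C\<close> and 1 at \<open>w\<close>; adjoining the
  line through \<open>g - \<tau> w\<close>, on which this functional vanishes, keeps
  \<open>- w\<close> outside.\<close>

lemma poly_cone_extend_step:
  assumes C: "poly_cone C" and w: "- w \<notin> C"
    and core: "g + smult t0 w \<in> C" "- g + smult t1 w \<in> C"
  shows "\<exists>\<tau>. \<forall>x\<in>C. \<forall>l. x + smult l (g - smult \<tau> w) \<noteq> - w"
proof -
  note add = poly_cone_add[OF C] and scale = poly_cone_scale[OF C]
  \<comment> \<open>\<open>A\<close> holds lower bounds for the value at \<open>g\<close>, and the
    negatives of \<open>B\<close> are upper bounds; \<open>core\<close> makes both sets
    nonempty.\<close>
  define A where "A = {t. g - smult t w \<in> C}"
  define B where "B = {t. - g - smult t w \<in> C}"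
  have AB: "t \<le> - s" if "t \<in> A" "s \<in> B" for t s
  proof (rule ccontr)
    assume n: "\<not> t \<le> - s"
    have "(g - smult t w) + (- g - smult s w) \<in> C" using that by (intro add) (auto simp: A_def B_def)
    then have "smult (- (t + s)) w \<in> C" by (simp add: smult_diff_left)
    then have "smult (1 / (t + s)) (smult (- (t + s)) w) \<in> C" by (rule scale) (use n in simp)
    moreover have "1 / (t + s) * - (t + s) = - 1" using n by (simp add: field_simps)
    ultimately show False using w by (simp only: smult_smult) simp
  qed
  have "- t0 \<in> A" "- t1 \<in> B" using core by (auto simp: A_def B_def)
  define \<tau> where "\<tau> = Sup A"
  have bdd: "bdd_above A" using AB \<open>- t1 \<in> B\<close> by (meson bdd_above.I)
  have upA: "t \<le> \<tau>" if "t \<in> A" for t unfolding \<tau>_def using that bdd by (rule cSup_upper)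
  have upB: "\<tau> \<le> - s" if "s \<in> B" for s
    unfolding \<tau>_def using \<open>- t0 \<in> A\<close> AB that by (intro cSup_least) auto
  have "x + smult l (g - smult \<tau> w) \<noteq> - w" if x: "x \<in> C" for x l
  proof
    assume e: "x + smult l (g - smult \<tau> w) = - w"
    have xe: "x = - w - smult l (g - smult \<tau> w)" using e by (metis add_diff_cancel_right')
    \<comment> \<open>For \<open>l \<noteq> 0\<close>, scaling \<open>x\<close> by the inverse of
      the absolute value of \<open>l\<close> gives a bound that beats \<open>\<tau>\<close>: an
      element of \<open>A\<close> above it, or one of \<open>B\<close> whose negative lies below
      it.\<close>
    consider "l = 0" | "l < 0" | "l > 0" by linarith
    then show False
    proof cases
      case 1 then show False using e x w by simp
    next
      case 2
      have "smult (1 / - l) x = g - smult (\<tau> + 1 / - l) w"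
        unfolding xe using 2 by (simp add: smult_diff_right smult_add_left smult_diff_left)
      then have "\<tau> + 1 / - l \<in> A" using scale[OF x, of "1 / - l"] 2 by (simp add: A_def)
      then show False using upA 2 by (smt (verit) divide_pos_pos)
    next
      case 3
      have "smult (1 / l) x = - g - smult (1 / l - \<tau>) w"
        unfolding xe using 3 by (simp add: smult_diff_right smult_add_left smult_diff_left)
      then have "1 / l - \<tau> \<in> B" using scale[OF x, of "1 / l"] 3 by (simp add: B_def)
      then show False using upB 3 by (smt (verit) divide_pos_pos)
    qed
  qed
  then show ?thesis by blast
qed

lemma poly_cone_extend:
  assumes C: "poly_cone C" and w: "- w \<notin> C"
    and core: "\<And>m. m < n \<Longrightarrow> \<exists>t. monom 1 m + smult t w \<in> C"
              "\<And>m. m < n \<Longrightarrow> \<exists>t. - monom 1 m + smult t w \<in> C"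
  shows "\<exists>\<tau>. \<forall>x\<in>C. \<forall>l. x + (\<Sum>m<n. smult (l m) (monom 1 m - smult (\<tau> m) w)) \<noteq> - w"
  using core
proof (induction n)
  case 0
  then show ?case using w by auto
next
  case (Suc n)
  then obtain \<tau> where \<tau>: "\<forall>x\<in>C. \<forall>l. x + (\<Sum>m<n. smult (l m) (monom 1 m - smult (\<tau> m) w)) \<noteq> - w"
    by auto
  define S where "S = (\<lambda>l. \<Sum>m<n. smult (l m) (monom 1 m - smult (\<tau> m) w))"
  \<comment> \<open>\<open>D\<close> is the cone enlarged by the lines chosen so far. It contains
    \<open>C\<close>, so the interior condition on \<open>w\<close> carries over.\<close>
  define D where "D = {x + S l | x l. x \<in> C}"
  have S_add: "S l + S l' = S (\<lambda>m. l m + l' m)" for l l'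
    by (simp add: S_def smult_add_left sum.distrib)
  have S_scale: "smult a (S l) = S (\<lambda>m. a * l m)" for a l
    by (simp add: S_def smult_sum_right)
  have S0: "S (\<lambda>_. 0) = 0" by (simp add: S_def)
  have CD: "x \<in> D" if "x \<in> C" for x
    using that S0 unfolding D_def by (metis (mono_tags, lifting) add.right_neutral mem_Collect_eq)
  have "poly_cone D"
    unfolding poly_cone_def
  proof (intro conjI ballI allI impI)
    show "0 \<in> D" using C CD by (auto simp: poly_cone_def)
  next
    fix x y assume "x \<in> D" "y \<in> D"
    then obtain u l v l' where "x = u + S l" "y = v + S l'" "u \<in> C" "v \<in> C" by (auto simp: D_def)
    then have "x + y = (u + v) + S (\<lambda>m. l m + l' m)" "u + v \<in> C"
      using C by (auto simp: S_add[symmetric] poly_cone_def)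
    then show "x + y \<in> D" by (auto simp: D_def)
  next
    fix x and a :: real assume "x \<in> D" "a \<ge> 0"
    then obtain u l where "x = u + S l" "u \<in> C" by (auto simp: D_def)
    then have "smult a x = smult a u + S (\<lambda>m. a * l m)" "smult a u \<in> C"
      using C \<open>a \<ge> 0\<close> by (auto simp: S_scale[symmetric] smult_add_right poly_cone_def)
    then show "smult a x \<in> D" by (auto simp: D_def)
  qed
  moreover have "- w \<notin> D"
  proof
    assume "- w \<in> D"
    then obtain x l where "x \<in> C" "- w = x + S l" by (auto simp: D_def)
    then show False using \<tau> unfolding S_def by metis
  qed
  moreover obtain t0 t1 where "monom 1 n + smult t0 w \<in> D" "- monom 1 n + smult t1 w \<in> D"
    using Suc.prems CD by blast
  ultimately obtain \<tau>' where \<tau>': "\<forall>x\<in>D. \<forall>l. x + smult l (monom 1 n - smult \<tau>' w) \<noteq> - w"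
    using poly_cone_extend_step by blast
  show ?case
  proof (intro exI[of _ "\<tau>(n := \<tau>')"] ballI allI)
    fix x l assume "x \<in> C"
    then have "x + S l \<in> D" by (auto simp: D_def)
    then have "(x + S l) + smult (l n) (monom 1 n - smult \<tau>' w) \<noteq> - w" using \<tau>' by blast
    moreover have "S l = (\<Sum>m<n. smult (l m) (monom 1 m - smult ((\<tau>(n := \<tau>')) m) w))"
      by (simp add: S_def)
    ultimately show "x + (\<Sum>m<Suc n. smult (l m) (monom 1 m - smult ((\<tau>(n := \<tau>')) m) w)) \<noteq> - w"
      by (simp add: add.assoc)
  qed
qed

text \<open>The cone need not be closed or finitely generated; instead, \<open>w\<close> is required to be an interior direction.\<close>

lemma poly_cone_separation:
  assumes C: "poly_cone C" and w: "- w \<notin> C" "degree w \<le> p"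
    and core: "\<And>m. m \<le> p \<Longrightarrow> \<exists>t. monom 1 m + smult t w \<in> C"
              "\<And>m. m \<le> p \<Longrightarrow> \<exists>t. - monom 1 m + smult t w \<in> C"
  shows "\<exists>Q. Q \<noteq> 0 \<and> degree Q \<le> p \<and>
           (\<forall>V\<in>C. degree V \<le> p \<longrightarrow> 0 \<le> (\<Sum>m\<le>p. coeff Q m * coeff V m))"
proof -
  have "\<exists>\<tau>. \<forall>x\<in>C. \<forall>l. x + (\<Sum>m<Suc p. smult (l m) (monom 1 m - smult (\<tau> m) w)) \<noteq> - w"
    by (rule poly_cone_extend[OF C w(1)]) (use core in \<open>auto simp: less_Suc_eq_le\<close>)
  then obtain \<tau> where \<tau>: "\<And>x l. x \<in> C \<Longrightarrow> x + (\<Sum>m\<le>p. smult (l m) (monom 1 m - smult (\<tau> m) w)) \<noteq> - w"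
    unfolding lessThan_Suc_atMost by blast
  \<comment> \<open>\<open>q\<close> is the functional with value \<open>\<tau> m\<close> at the
    \<open>m\<close>-th monomial. The fact \<open>dec\<close> puts \<open>V - q(V) w\<close> into
    the span of the adjoined lines.\<close>
  define q where "q = (\<lambda>V. \<Sum>m\<le>p. \<tau> m * coeff V m)"
  have dec: "V - smult (q V) w = (\<Sum>m\<le>p. smult (coeff V m) (monom 1 m - smult (\<tau> m) w))"
    if "degree V \<le> p" for V
  proof -
    have "(\<Sum>m\<le>p. smult (coeff V m) (monom 1 m - smult (\<tau> m) w)) =
        (\<Sum>m\<le>p. smult (coeff V m) (monom 1 m)) - (\<Sum>m\<le>p. smult (\<tau> m * coeff V m) w)"
      unfolding sum_subtractf[symmetric] by (simp add: smult_diff_right mult.commute)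
    also have "(\<Sum>m\<le>p. smult (\<tau> m * coeff V m) w) = smult (q V) w"
      unfolding q_def by (simp add: smult_sum)
    finally show ?thesis using poly_eq_sum_monom[OF that] by simp
  qed
  have scaled: "(\<Sum>m\<le>p. smult (a * l m) (monom 1 m - smult (\<tau> m) w)) =
     smult a (\<Sum>m\<le>p. smult (l m) (monom 1 m - smult (\<tau> m) w))" for a l
    by (simp only: smult_smult[symmetric] smult_sum_right)
  have nonneg: "0 \<le> q V" if "V \<in> C" "degree V \<le> p" for V
  proof (rule ccontr)
    assume n: "\<not> 0 \<le> q V"
    \<comment> \<open>Scaled so that \<open>q\<close> becomes \<open>-1\<close>, \<open>V\<close>
      differs from \<open>- w\<close> only by an element of the span, which the choice of
      \<open>\<tau>\<close> forbids.\<close>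
    let ?a = "1 / - q V"
    have "smult ?a V + (\<Sum>m\<le>p. smult (- ?a * coeff V m) (monom 1 m - smult (\<tau> m) w)) =
       smult ?a V + smult (- ?a) (V - smult (q V) w)"
      by (simp only: scaled dec[OF that(2)])
    also have "\<dots> = - w" using n by (simp add: smult_diff_right)
    finally have "smult ?a V + (\<Sum>m\<le>p. smult (- ?a * coeff V m) (monom 1 m - smult (\<tau> m) w)) = - w" .
    moreover have "smult ?a V \<in> C" by (rule poly_cone_scale[OF C that(1)]) (use n in simp)
    ultimately show False using \<tau> by metis
  qed
  have "q w = 1"
  proof (rule ccontr)
    assume n: "q w \<noteq> 1"
    \<comment> \<open>If \<open>q w \<noteq> 1\<close>, then \<open>w\<close> is a multiple of
      \<open>w - q(w) w\<close>, so \<open>- w\<close> already lies in the span.\<close>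
    let ?a = "- 1 / (1 - q w)"
    have "0 + (\<Sum>m\<le>p. smult (?a * coeff w m) (monom 1 m - smult (\<tau> m) w)) =
       smult ?a (w - smult (q w) w)"
      by (simp only: scaled dec[OF w(2)] add_0_left)
    also have "\<dots> = smult (?a * (1 - q w)) w"
      by (simp only: smult_diff_right smult_smult right_diff_distrib smult_diff_left mult_1_right)
    also have "\<dots> = - w" using n by simp
    finally have "0 + (\<Sum>m\<le>p. smult (?a * coeff w m) (monom 1 m - smult (\<tau> m) w)) = - w" .
    moreover have "0 \<in> C" using C by (simp add: poly_cone_def)
    ultimately show False using \<tau> by metis
  qed
  define Q where "Q = (\<Sum>m\<le>p. monom (\<tau> m) m)"
  have cQ: "coeff Q m = \<tau> m" if "m \<le> p" for m
    using that by (simp add: Q_def coeff_sum)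
  have "Q \<noteq> 0"
  proof
    assume "Q = 0"
    then have "q w = 0" using cQ by (simp add: q_def)
    then show False using \<open>q w = 1\<close> by simp
  qed
  moreover have "degree Q \<le> p"
    unfolding Q_def by (intro degree_sum_le) (auto intro: order_trans[OF degree_monom_le])
  moreover have "(\<Sum>m\<le>p. coeff Q m * coeff V m) = q V" for V
    using cQ by (simp add: q_def)
  ultimately show ?thesis using nonneg by auto
qed

subsection \<open>Dual certificates\<close>

lemma degree_prod_linear_le:
  assumes "finite A"
  shows "degree (\<Prod>i\<in>A. [:- f i, 1 :: real:]) = card A"
  using assms by (subst degree_prod_eq_sum_degree) auto

text \<open>Expresses every linear functional in degree at most \<open>p\<close> through evaluations
  at \<open>p + 1\<close> nodes; this is what makes the sum of these evaluations an interior
  direction of the cone below.\<close>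

lemma lagrange_interpolation:
  fixes A :: "real set"
  assumes "finite A" "card A = Suc p"
  shows "\<exists>L. \<forall>P :: real poly. degree P \<le> p \<longrightarrow> P = (\<Sum>a\<in>A. smult (poly P a) (L a))"
proof -
  define L where "L = (\<lambda>a. smult (1 / (\<Prod>b\<in>A - {a}. a - b)) (\<Prod>b\<in>A - {a}. [:- b, 1:]))"
  have val: "poly (L a) b = (if a = b then 1 else 0)" if "a \<in> A" "b \<in> A" for a b
  proof (cases "a = b")
    case True
    have "(\<Prod>b\<in>A - {a}. a - b) \<noteq> 0" using assms(1) by auto
    then show ?thesis using True by (simp add: L_def poly_prod)
  next
    case False
    then have "(\<Prod>c\<in>A - {a}. poly [:- c, 1:] b) = 0"
      using assms(1) that by (intro prod_zero) auto
    then show ?thesis using False by (simp add: L_def poly_prod)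
  qed
  have deg: "degree (L a) \<le> p" if "a \<in> A" for a
    unfolding L_def using assms that
    by (intro order_trans[OF degree_smult_le]) (simp add: degree_prod_linear_le)
  show ?thesis
  proof (intro exI[of _ L] allI impI)
    fix P :: "real poly" assume P: "degree P \<le> p"
    show "P = (\<Sum>a\<in>A. smult (poly P a) (L a))"
    proof (rule poly_eqI_degree[of A])
      fix b assume b: "b \<in> A"
      have "(\<Sum>a\<in>A. poly P a * poly (L a) b) = (\<Sum>a\<in>A. if a = b then poly P a else 0)"
        using val b by (intro sum.cong) auto
      then show "poly P b = poly (\<Sum>a\<in>A. smult (poly P a) (L a)) b"
        using b assms(1) by (simp add: poly_sum)
    next
      have "degree (\<Sum>a\<in>A. smult (poly P a) (L a)) \<le> p"
        using assms(1) deg by (intro degree_sum_le) (auto intro: order_trans[OF degree_smult_le])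
      then show "degree (\<Sum>a\<in>A. smult (poly P a) (L a)) < card A" using assms(2) by simp
    qed (use P assms in simp)
  qed
qed

text \<open>Separation only supplies \<open>Q(0) \<le> 0\<close>; equality is recovered later by
  testing against nearly optimal methods.\<close>

definition weak_cert :: "real \<Rightarrow> real poly \<Rightarrow> bool" where
  "weak_cert c Q \<longleftrightarrow> Q \<noteq> 0 \<and> poly Q 0 \<le> 0 \<and> poly (pderiv Q) 0 \<le> 0 \<and>
     (\<forall>j\<ge>1. 0 \<le> poly Q (real j) \<and> poly (pderiv Q) (real j) \<le> c * poly Q (real j))"

text \<open>The moment vector of \<open>f\<close>. Its coefficientwise pairing with \<open>Q\<close>
  recovers \<open>f Q\<close>, see \<open>functional_poly_pair\<close>.\<close>

definition functional_poly :: "nat \<Rightarrow> (real poly \<Rightarrow> real) \<Rightarrow> real poly" where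
  "functional_poly p f = (\<Sum>m\<le>p. monom (f (monom 1 m)) m)"

lemma coeff_functional_poly: "coeff (functional_poly p f) m = (if m \<le> p then f (monom 1 m) else 0)"
  by (simp add: functional_poly_def coeff_sum)

lemma degree_functional_poly: "degree (functional_poly p f) \<le> p"
  by (intro degree_le) (simp add: coeff_functional_poly)

section \<open>The convex cone of moment vectors of methods\<close>

lemma ssp_nonneg_max:
  assumes "ssp_nonneg c k \<alpha> \<beta>" "\<forall>j>k. \<alpha> j = 0 \<and> \<beta> j = 0"
  shows "ssp_nonneg c k' \<alpha> \<beta>"
  unfolding ssp_nonneg_def
proof (intro conjI ballI)
  fix j assume "j \<in> {1..k'}"
  then have "0 \<le> \<alpha> j \<and> c * \<beta> j \<le> \<alpha> j"
    using assms by (cases "j \<le> k") (auto simp: ssp_nonneg_def)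
  then show "0 \<le> \<alpha> j" "c * \<beta> j \<le> \<alpha> j" by auto
next
  fix j assume "j \<in> {0..k'}"
  then show "0 \<le> \<beta> j"
    using assms by (cases "j \<le> k") (auto simp: ssp_nonneg_def)
qed

lemma lm_functional_max:
  assumes "\<forall>j>k. \<alpha> j = 0 \<and> \<beta> j = 0" "k \<le> k'"
  shows "lm_functional k' \<alpha> \<beta> P = lm_functional k \<alpha> \<beta> P"
proof -
  have "(\<Sum>j=1..k'. \<alpha> j * poly P (real j) - \<beta> j * poly (pderiv P) (real j)) =
        (\<Sum>j=1..k. \<alpha> j * poly P (real j) - \<beta> j * poly (pderiv P) (real j))"
    by (rule sum.mono_neutral_right) (use assms in auto)
  then show ?thesis by (simp add: lm_functional_def)
qed

lemma lm_functional_add_coeffs: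
  "lm_functional k (\<lambda>j. \<alpha> j + \<alpha>' j) (\<lambda>j. \<beta> j + \<beta>' j) P =
   lm_functional k \<alpha> \<beta> P + lm_functional k \<alpha>' \<beta>' P"
proof -
  have "(\<Sum>j=1..k. (\<alpha> j + \<alpha>' j) * poly P (real j) - (\<beta> j + \<beta>' j) * poly (pderiv P) (real j)) =
     (\<Sum>j=1..k. \<alpha> j * poly P (real j) - \<beta> j * poly (pderiv P) (real j)) +
     (\<Sum>j=1..k. \<alpha>' j * poly P (real j) - \<beta>' j * poly (pderiv P) (real j))"
    unfolding sum.distrib[symmetric] by (rule sum.cong) (auto simp: algebra_simps)
  then show ?thesis unfolding lm_functional_def by (simp add: algebra_simps)
qed

lemma lm_functional_scale_coeffs:
  "lm_functional k (\<lambda>j. a * \<alpha> j) (\<lambda>j. a * \<beta> j) P = a * lm_functional k \<alpha> \<beta> P"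
  by (simp add: lm_functional_def sum_distrib_left algebra_simps)

lemma ssp_nonneg_add:
  assumes "ssp_nonneg c k \<alpha> \<beta>" "ssp_nonneg c k \<alpha>' \<beta>'"
  shows "ssp_nonneg c k (\<lambda>j. \<alpha> j + \<alpha>' j) (\<lambda>j. \<beta> j + \<beta>' j)"
  using assms unfolding ssp_nonneg_def by (auto simp: distrib_left intro: add_mono)

lemma ssp_nonneg_scale:
  assumes "ssp_nonneg c k \<alpha> \<beta>" "0 \<le> a"
  shows "ssp_nonneg c k (\<lambda>j. a * \<alpha> j) (\<lambda>j. a * \<beta> j)"
  using assms unfolding ssp_nonneg_def
  by (auto simp: mult.left_commute[of c a] intro: mult_left_mono)

text \<open>The strict \<open>c' > c\<close> ensures that evaluation at 0 lies in the cone only if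
  \<open>c\<close> can be exceeded. The part \<open>- t P(0)\<close> is what yields
  \<open>Q(0) \<le> 0\<close> for the dual polynomial. Coefficients vanish beyond \<open>k\<close>
  so that elements of different length can be added.\<close>

definition ssp_cone :: "nat \<Rightarrow> real \<Rightarrow> real poly set" where
  "ssp_cone p c = {functional_poly p (\<lambda>P. lm_functional k \<alpha> \<beta> P - t * poly P 0) | k \<alpha> \<beta> t.
     0 \<le> t \<and> (\<forall>j>k. \<alpha> j = 0 \<and> \<beta> j = 0) \<and> (\<exists>c'>c. ssp_nonneg c' k \<alpha> \<beta>)}"

lemma poly_cone_ssp_cone: "poly_cone (ssp_cone p c)"
  unfolding poly_cone_def
proof (intro conjI ballI allI impI)
  show "0 \<in> ssp_cone p c"
    unfolding ssp_cone_def
    by (rule CollectI, rule exI[of _ 0], rule exI[of _ "\<lambda>_. 0"], rule exI[of _ "\<lambda>_. 0"], rule exI[of _ 0])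
       (auto simp: functional_poly_def lm_functional_def ssp_nonneg_def intro: gt_ex)
next
  fix x y assume "x \<in> ssp_cone p c" "y \<in> ssp_cone p c"
  then obtain k \<alpha> \<beta> t c1 k' \<alpha>' \<beta>' t' c2 where
    x: "x = functional_poly p (\<lambda>P. lm_functional k \<alpha> \<beta> P - t * poly P 0)" "0 \<le> t"
      "\<forall>j>k. \<alpha> j = 0 \<and> \<beta> j = 0" "c < c1" "ssp_nonneg c1 k \<alpha> \<beta>" and
    y: "y = functional_poly p (\<lambda>P. lm_functional k' \<alpha>' \<beta>' P - t' * poly P 0)" "0 \<le> t'"
      "\<forall>j>k'. \<alpha>' j = 0 \<and> \<beta>' j = 0" "c < c2" "ssp_nonneg c2 k' \<alpha>' \<beta>'"
    unfolding ssp_cone_def by auto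
  let ?k = "max k k'"
  let ?a = "\<lambda>j. \<alpha> j + \<alpha>' j" and ?b = "\<lambda>j. \<beta> j + \<beta>' j"
  have "x + y = functional_poly p (\<lambda>P. lm_functional ?k ?a ?b P - (t + t') * poly P 0)"
    using lm_functional_max[OF x(3), of ?k] lm_functional_max[OF y(3), of ?k]
    by (intro poly_eqI)
      (simp add: x(1) y(1) coeff_functional_poly lm_functional_add_coeffs algebra_simps)
  moreover have "ssp_nonneg (min c1 c2) ?k ?a ?b"
    by (intro ssp_nonneg_add ssp_nonneg_antimono[OF ssp_nonneg_max[OF x(5,3)]]
        ssp_nonneg_antimono[OF ssp_nonneg_max[OF y(5,3)]]) simp_all
  then have "\<exists>c'>c. ssp_nonneg c' ?k ?a ?b" using x(4) y(4) by (intro exI[of _ "min c1 c2"]) simp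
  moreover have "\<forall>j>?k. ?a j = 0 \<and> ?b j = 0" using x(3) y(3) by auto
  ultimately show "x + y \<in> ssp_cone p c"
    unfolding ssp_cone_def using x(2) y(2)
    by (intro CollectI exI[of _ ?k] exI[of _ ?a] exI[of _ ?b] exI[of _ "t + t'"]) auto
next
  fix x and a :: real assume "x \<in> ssp_cone p c" "0 \<le> a"
  then obtain k \<alpha> \<beta> t c1 where
    x: "x = functional_poly p (\<lambda>P. lm_functional k \<alpha> \<beta> P - t * poly P 0)" "0 \<le> t"
      "\<forall>j>k. \<alpha> j = 0 \<and> \<beta> j = 0" "c < c1" "ssp_nonneg c1 k \<alpha> \<beta>"
    unfolding ssp_cone_def by auto
  let ?a = "\<lambda>j. a * \<alpha> j" and ?b = "\<lambda>j. a * \<beta> j"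
  have "smult a x = functional_poly p (\<lambda>P. lm_functional k ?a ?b P - (a * t) * poly P 0)"
    by (intro poly_eqI)
      (simp add: x(1) coeff_functional_poly lm_functional_scale_coeffs algebra_simps)
  moreover have "ssp_nonneg c1 k ?a ?b" using x(5) \<open>0 \<le> a\<close> by (rule ssp_nonneg_scale)
  ultimately show "smult a x \<in> ssp_cone p c"
    unfolding ssp_cone_def using x \<open>0 \<le> a\<close>
    by (intro CollectI exI[of _ k] exI[of _ ?a] exI[of _ ?b] exI[of _ "a * t"]) auto
qed

lemma ssp_cone_memI:
  assumes "0 \<le> t" "\<forall>j>k. \<alpha> j = 0 \<and> \<beta> j = 0" "c < c'" "ssp_nonneg c' k \<alpha> \<beta>"
    "\<And>m. m \<le> p \<Longrightarrow> f (monom 1 m) = lm_functional k \<alpha> \<beta> (monom 1 m) - t * poly (monom 1 m) 0"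
  shows "functional_poly p f \<in> ssp_cone p c"
proof -
  have "functional_poly p f = functional_poly p (\<lambda>P. lm_functional k \<alpha> \<beta> P - t * poly P 0)"
    by (intro poly_eqI) (simp add: coeff_functional_poly assms(5))
  then show ?thesis unfolding ssp_cone_def using assms(1-4) by blast
qed

lemma sum_delta_atLeastAtMost:
  fixes f :: "nat \<Rightarrow> real"
  shows "(\<Sum>j=1..k. (if j = i then a else 0) * f j) = (if 1 \<le> i \<and> i \<le> k then a * f i else 0)"
proof -
  have "(\<Sum>j=1..k. (if j = i then a else 0) * f j) = (\<Sum>j=1..k. if j = i then a * f j else 0)"
    by (intro sum.cong) auto
  then show ?thesis by auto
qed

lemma ssp_cone_point:
  assumes "1 \<le> j" "0 \<le> a"
  shows "functional_poly p (\<lambda>P. a * poly P (real j)) \<in> ssp_cone p c"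
  by (rule ssp_cone_memI[where t = 0 and k = j and \<alpha> = "\<lambda>i. if i = j then a else 0"
        and \<beta> = "\<lambda>_. 0" and c' = "c + 1"])
    (use assms in \<open>auto simp: ssp_nonneg_def lm_functional_def sum_delta_atLeastAtMost[unfolded One_nat_def]\<close>)

lemma ssp_cone_deriv:
  assumes "1 \<le> j" "c < c'" "0 \<le> c'"
  shows "functional_poly p (\<lambda>P. c' * poly P (real j) - poly (pderiv P) (real j)) \<in> ssp_cone p c"
  by (rule ssp_cone_memI[where t = 0 and k = j and \<alpha> = "\<lambda>i. if i = j then c' else 0"
        and \<beta> = "\<lambda>i. if i = j then 1 else 0" and c' = c'])
    (use assms in \<open>auto simp: ssp_nonneg_def lm_functional_def sum_delta_atLeastAtMost[unfolded One_nat_def] sum_subtractf\<close>)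

lemma ssp_cone_deriv_0: "functional_poly p (\<lambda>P. - poly (pderiv P) 0) \<in> ssp_cone p c"
  by (rule ssp_cone_memI[where t = 0 and k = 0 and \<alpha> = "\<lambda>i. 0"
        and \<beta> = "\<lambda>i. if i = 0 then 1 else 0" and c' = "c + 1"])
    (auto simp: ssp_nonneg_def lm_functional_def)

lemma ssp_cone_neg_eval_0: "functional_poly p (\<lambda>P. - poly P 0) \<in> ssp_cone p c"
  by (rule ssp_cone_memI[where t = 1 and k = 0 and \<alpha> = "\<lambda>i. 0"
        and \<beta> = "\<lambda>i. 0" and c' = "c + 1"])
    (auto simp: ssp_nonneg_def lm_functional_def)

text \<open>Moving \<open>- t P(0)\<close> to the other side gives a method reproducing
  \<open>(1 + t) P(0)\<close>; division by \<open>1 + t\<close> normalises it.\<close>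

lemma ssp_cone_eval_0:
  assumes "functional_poly p (\<lambda>P. poly P 0) \<in> ssp_cone p c"
  shows "\<exists>k. \<exists>c'>c. ssp_feasible k p c'"
proof -
  obtain k \<alpha> \<beta> t c' where
    x: "functional_poly p (\<lambda>P. poly P 0) = functional_poly p (\<lambda>P. lm_functional k \<alpha> \<beta> P - t * poly P 0)"
      "0 \<le> t" "c < c'" "ssp_nonneg c' k \<alpha> \<beta>"
    using assms unfolding ssp_cone_def by blast
  let ?a = "1 / (1 + t)"
  have "lm_functional k (\<lambda>j. ?a * \<alpha> j) (\<lambda>j. ?a * \<beta> j) (monom 1 m) = 0 ^ m" if "m \<le> p" for m
  proof -
    have "0 ^ m = lm_functional k \<alpha> \<beta> (monom 1 m) - t * 0 ^ m"
      using arg_cong[OF x(1), of "\<lambda>P. coeff P m"] that by (simp add: coeff_functional_poly poly_monom)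
    then have "lm_functional k \<alpha> \<beta> (monom 1 m) = (1 + t) * 0 ^ m" by (simp add: algebra_simps)
    then show ?thesis using x(2) by (simp only: lm_functional_scale_coeffs) simp
  qed
  then have "lm_order k p (\<lambda>j. ?a * \<alpha> j) (\<lambda>j. ?a * \<beta> j)" by (simp add: lm_order_iff_monom)
  moreover have "ssp_nonneg c' k (\<lambda>j. ?a * \<alpha> j) (\<lambda>j. ?a * \<beta> j)"
    by (intro ssp_nonneg_scale x(4)) (use x(2) in simp)
  ultimately show ?thesis using x(3) unfolding ssp_feasible_def by blast
qed

lemma functional_poly_pair:
  assumes "degree Q \<le> p" "\<And>P P'. f (P + P') = f P + f P'" "\<And>a P. f (smult a P) = a * f P"
  shows "(\<Sum>m\<le>p. coeff Q m * coeff (functional_poly p f) m) = f Q"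
proof -
  have f0: "f 0 = 0" using assms(3)[of 0 0] by simp
  have fsum: "f (\<Sum>i\<in>A. g i) = (\<Sum>i\<in>A. f (g i))" for A :: "nat set" and g
    by (induction A rule: infinite_finite_induct) (auto simp: f0 assms(2))
  have "f Q = f (\<Sum>m\<le>p. smult (coeff Q m) (monom 1 m))"
    using poly_eq_sum_monom[OF assms(1)] by simp
  also have "\<dots> = (\<Sum>m\<le>p. coeff Q m * f (monom 1 m))" by (simp only: fsum assms(3))
  finally show ?thesis by (simp add: coeff_functional_poly)
qed

text \<open>Strong duality. By \<open>inf\<close>, evaluation at 0 lies outside the cone, so a
  separating \<open>Q\<close> exists; the clauses of \<open>weak_cert\<close> are its nonnegativity
  on the generators \<open>P(j)\<close>, \<open>c' P(j) - P'(j)\<close>, \<open>- P'(0)\<close> and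
  \<open>- P(0)\<close>.\<close>

lemma weak_cert_exists:
  assumes c: "0 \<le> c" and inf: "\<And>k c'. ssp_feasible k p c' \<Longrightarrow> c' \<le> c"
  shows "\<exists>Q. weak_cert c Q \<and> degree Q \<le> p"
proof -
  define C where "C = ssp_cone p c"
  have cone: "poly_cone C" unfolding C_def by (rule poly_cone_ssp_cone)
  define A where "A = real ` {1..Suc p}"
  have A: "finite A" "card A = Suc p" by (simp_all add: A_def card_image)
  obtain L where L: "\<And>P :: real poly. degree P \<le> p \<Longrightarrow> P = (\<Sum>a\<in>A. smult (poly P a) (L a))"
    using lagrange_interpolation[OF A] by blast
  define w where "w = functional_poly p (\<lambda>P. \<Sum>a\<in>A. poly P a)"
  note Cadd = poly_cone_add[OF cone]
  have Csum: "(\<Sum>i\<in>B. g i) \<in> C" if "\<And>i. i \<in> B \<Longrightarrow> g i \<in> C" for B :: "real set" and g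
    using that by (induction B rule: infinite_finite_induct)
      (use cone in \<open>auto simp: poly_cone_def intro!: Cadd\<close>)
  have core: "\<exists>t\<ge>0. functional_poly p f + smult t w \<in> C"
    if add: "\<And>P P'. f (P + P') = f P + f P'" and scale: "\<And>a P. f (smult a P) = a * f P" for f
  proof -
    \<comment> \<open>\<open>t\<close> dominates all weights of \<open>f\<close> in its Lagrange
      form, so \<open>f + t w\<close> has nonnegative weights at the nodes and lies in the
      cone.\<close>
    define t where "t = (\<Sum>a\<in>A. \<bar>f (L a)\<bar>)"
    have t: "0 \<le> f (L a) + t" if "a \<in> A" for a
      using member_le_sum[of a A "\<lambda>a. \<bar>f (L a)\<bar>"] A(1) that unfolding t_def by force
    have f0: "f 0 = 0" using scale[of 0 0] by simp
    have fsum: "f (\<Sum>i\<in>B. g i) = (\<Sum>i\<in>B. f (g i))" for B :: "real set" and g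
      by (induction B rule: infinite_finite_induct) (auto simp: f0 add)
    have "functional_poly p f + smult t w =
        (\<Sum>a\<in>A. functional_poly p (\<lambda>P. (f (L a) + t) * poly P a))"
    proof (rule poly_eqI)
      fix m
      show "coeff (functional_poly p f + smult t w) m =
        coeff (\<Sum>a\<in>A. functional_poly p (\<lambda>P. (f (L a) + t) * poly P a)) m"
      proof (cases "m \<le> p")
        case True
        then have "f (monom 1 m) = f (\<Sum>a\<in>A. smult (poly (monom 1 m) a) (L a))"
          using L[of "monom 1 m"] by (simp add: degree_monom_eq)
        also have "\<dots> = (\<Sum>a\<in>A. poly (monom 1 m) a * f (L a))" by (simp only: fsum scale)
        finally show ?thesis using True
          by (simp add: coeff_functional_poly coeff_sum w_def sum_distrib_left algebra_simps sum.distrib)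
      qed (simp add: coeff_functional_poly coeff_sum w_def)
    qed
    also have "\<dots> \<in> C"
      unfolding C_def[symmetric]
    proof (rule Csum)
      fix a assume "a \<in> A"
      then obtain j where j: "a = real j" "1 \<le> j" by (auto simp: A_def)
      show "functional_poly p (\<lambda>P. (f (L a) + t) * poly P a) \<in> C"
        unfolding C_def j(1) using t[OF \<open>a \<in> A\<close>] j by (intro ssp_cone_point) auto
    qed
    finally show ?thesis using abs_ge_zero by (intro exI[of _ t]) (auto simp: t_def sum_nonneg)
  qed
  \<comment> \<open>Otherwise \<open>t w\<close> could be subtracted from evaluation at 0 plus
    \<open>t w\<close> inside the cone, leaving evaluation at 0 itself.\<close>
  have "- w \<notin> C"
  proof
    assume w: "- w \<in> C"
    obtain t where t: "t \<ge> 0" "functional_poly p (\<lambda>P. poly P 0) + smult t w \<in> C"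
      using core[of "\<lambda>P. poly P 0"] by auto
    have "functional_poly p (\<lambda>P. poly P 0) + smult t w + smult t (- w) \<in> C"
      by (rule Cadd[OF t(2) poly_cone_scale[OF cone w t(1)]])
    then have "functional_poly p (\<lambda>P. poly P 0) \<in> C" by simp
    then obtain k c' where "c' > c" "ssp_feasible k p c'"
      unfolding C_def using ssp_cone_eval_0 by blast
    then show False using inf[of k c'] by simp
  qed
  moreover have "\<exists>t. monom 1 m + smult t w \<in> C" "\<exists>t. - monom 1 m + smult t w \<in> C" if "m \<le> p" for m
  proof -
    have "functional_poly p (\<lambda>P. coeff P m) = monom 1 m"
      "functional_poly p (\<lambda>P. - coeff P m) = - monom 1 m"
      using that by (auto intro!: poly_eqI simp: coeff_functional_poly)
    then show "\<exists>t. monom 1 m + smult t w \<in> C" "\<exists>t. - monom 1 m + smult t w \<in> C"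
      using core[of "\<lambda>P. coeff P m"] core[of "\<lambda>P. - coeff P m"] by auto
  qed
  moreover have "degree w \<le> p" unfolding w_def by (rule degree_functional_poly)
  ultimately have "\<exists>Q. Q \<noteq> 0 \<and> degree Q \<le> p \<and>
      (\<forall>V\<in>C. degree V \<le> p \<longrightarrow> 0 \<le> (\<Sum>m\<le>p. coeff Q m * coeff V m))"
    by (intro poly_cone_separation[OF cone])
  then obtain Q where Q: "Q \<noteq> 0" "degree Q \<le> p"
    and pos: "\<And>V. V \<in> C \<Longrightarrow> degree V \<le> p \<Longrightarrow> 0 \<le> (\<Sum>m\<le>p. coeff Q m * coeff V m)"
    by blast
  have pos': "0 \<le> f Q" if "functional_poly p f \<in> C"
    "\<And>P P'. f (P + P') = f P + f P'" "\<And>a P. f (smult a P) = a * f P" for f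
    using pos[OF that(1) degree_functional_poly] functional_poly_pair[OF Q(2), of f] that by simp
  have "poly Q 0 \<le> 0"
    using pos'[of "\<lambda>P. - poly P 0"] ssp_cone_neg_eval_0 by (simp add: C_def)
  moreover have "poly (pderiv Q) 0 \<le> 0"
    using pos'[of "\<lambda>P. - poly (pderiv P) 0"] ssp_cone_deriv_0
    by (simp add: C_def pderiv_add pderiv_smult)
  moreover have Qj: "0 \<le> poly Q (real j)" if "1 \<le> j" for j
    using pos'[of "\<lambda>P. 1 * poly P (real j)"] ssp_cone_point[OF that, of 1] by (simp add: C_def)
  moreover have "poly (pderiv Q) (real j) \<le> c * poly Q (real j)" if "1 \<le> j" for j
  proof (rule field_le_epsilon)
    fix e :: real assume e: "0 < e"
    \<comment> \<open>The cone contains the derivative generators only for \<open>c' > c\<close>;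
      this \<open>c'\<close> exceeds \<open>c\<close> by so little that the extra term stays below
      \<open>e\<close>.\<close>
    define c' where "c' = c + e / (1 + poly Q (real j))"
    have q: "0 < 1 + poly Q (real j)" using Qj[OF that] by simp
    have "c < c'" using e q by (simp add: c'_def)
    have "poly (pderiv Q) (real j) \<le> c' * poly Q (real j)"
      using pos'[of "\<lambda>P. c' * poly P (real j) - poly (pderiv P) (real j)"] \<open>c < c'\<close>
        ssp_cone_deriv[OF that \<open>c < c'\<close>] c
      by (simp add: C_def pderiv_add pderiv_smult algebra_simps)
    also have "\<dots> = c * poly Q (real j) + e * (poly Q (real j) / (1 + poly Q (real j)))"
      by (simp add: c'_def algebra_simps)
    also have "\<dots> \<le> c * poly Q (real j) + e"
      using q e Qj[OF that] by (simp add: field_simps)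
    finally show "poly (pderiv Q) (real j) \<le> c * poly Q (real j) + e" .
  qed
  ultimately show ?thesis using Q unfolding weak_cert_def by blast
qed

subsection \<open>Certificates of prescribed degree\<close>

lemma lead_coeff_eqI:
  assumes "degree P \<le> d" "coeff P d \<noteq> 0"
  shows "degree P = d" "lead_coeff P = coeff P d"
  using assms le_degree[of P d] by (auto simp: order_antisym)

lemma poly_eventually_pos:
  fixes P :: "real poly"
  assumes "0 < lead_coeff P"
  shows "\<exists>N. \<forall>j\<ge>N. 0 < poly P (real j)"
proof -
  obtain n where n: "\<forall>x\<ge>n. lead_coeff P \<le> poly P x" using poly_pinfty_gt_lc[OF assms] by blast
  obtain N where "n \<le> real N" using real_arch_simple by blast
  then have "0 < poly P (real j)" if "j \<ge> N" for j
    using n that assms by (meson less_le_trans of_nat_mono order_trans)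
  then show ?thesis by blast
qed

lemma lead_coeff_pos:
  fixes P :: "real poly"
  assumes "P \<noteq> 0" "\<And>j. 1 \<le> j \<Longrightarrow> 0 \<le> poly P (real j)"
  shows "0 < lead_coeff P"
proof (rule ccontr)
  assume "\<not> 0 < lead_coeff P"
  then have "0 < lead_coeff (- P)" using assms(1) by (simp add: less_le)
  then obtain N where "\<forall>j\<ge>N. 0 < poly (- P) (real j)" using poly_eventually_pos by blast
  then have "0 < poly (- P) (real (max N 1))" by (meson max.cobounded1)
  then show False using assms(2)[of "max N 1"] by simp
qed

lemma poly_ge_power:
  fixes P :: "real poly"
  assumes "0 < lead_coeff P"
  shows "\<exists>\<kappa>>0. \<exists>N. \<forall>j\<ge>N. \<kappa> * real j ^ degree P \<le> poly P (real j)"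
proof -
  define R where "R = P - monom (lead_coeff P / 2) (degree P)"
  have "degree R \<le> degree P"
    unfolding R_def by (intro degree_diff_le) (auto intro: degree_monom_le)
  moreover have "coeff R (degree P) = lead_coeff P / 2" by (simp add: R_def)
  ultimately have "0 < lead_coeff R"
    using lead_coeff_eqI(2)[of R "degree P"] assms by simp
  then obtain N where "\<forall>j\<ge>N. 0 < poly R (real j)" using poly_eventually_pos by blast
  then have "\<forall>j\<ge>N. lead_coeff P / 2 * real j ^ degree P \<le> poly P (real j)"
    by (auto simp: R_def poly_monom intro: less_imp_le)
  then show ?thesis using assms by (intro exI[of _ "lead_coeff P / 2"]) auto
qed

lemma poly_le_power:
  fixes P :: "real poly"
  assumes "degree P \<le> p"
  shows "\<exists>C\<ge>0. \<forall>j\<ge>1. \<bar>poly P (real j)\<bar> \<le> C * real j ^ p"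
proof (intro exI[of _ "\<Sum>m\<le>degree P. \<bar>coeff P m\<bar>"] conjI allI impI)
  fix j :: nat assume j: "1 \<le> j"
  have "\<bar>poly P (real j)\<bar> \<le> (\<Sum>m\<le>degree P. \<bar>coeff P m\<bar> * real j ^ m)"
    unfolding poly_altdef by (rule order_trans[OF sum_abs]) (simp add: abs_mult)
  also have "\<dots> \<le> (\<Sum>m\<le>degree P. \<bar>coeff P m\<bar> * real j ^ p)"
    using assms j by (intro sum_mono mult_left_mono power_increasing) auto
  finally show "\<bar>poly P (real j)\<bar> \<le> (\<Sum>m\<le>degree P. \<bar>coeff P m\<bar>) * real j ^ p"
    by (simp add: sum_distrib_right)
qed (simp add: sum_nonneg)

lemma smult_minus_pderiv:
  fixes Q :: "real poly"
  assumes "0 < a" "0 < lead_coeff Q"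
  shows "degree (smult a Q - pderiv Q) = degree Q" "0 < lead_coeff (smult a Q - pderiv Q)"
proof -
  define R where "R = smult a Q - pderiv Q"
  have "degree R \<le> degree Q"
    unfolding R_def by (intro degree_diff_le) (auto simp: degree_pderiv)
  have q: "coeff R (degree Q) = a * lead_coeff Q" "0 < a * lead_coeff Q"
    using assms by (simp_all add: R_def coeff_pderiv coeff_eq_0)
  then have "coeff R (degree Q) \<noteq> 0" by linarith
  with \<open>degree R \<le> degree Q\<close> have "degree R = degree Q" by (rule lead_coeff_eqI)
  then have "degree R = degree Q" "0 < lead_coeff R" using q by simp_all
  then show "degree (smult a Q - pderiv Q) = degree Q" "0 < lead_coeff (smult a Q - pderiv Q)"
    by (simp_all only: R_def)
qed

lemma weak_cert_lead_coeff_pos: "weak_cert c Q \<Longrightarrow> 0 < lead_coeff Q"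
  by (rule lead_coeff_pos) (auto simp: weak_cert_def)

text \<open>Yields positivity of the limit coefficient. A nonconstant \<open>Q\<close> with positive
  leading coefficient has an eventually positive derivative, and a positive constant violates
  \<open>Q(0) \<le> 0\<close>.\<close>

lemma not_weak_cert_0: "\<not> weak_cert 0 Q"
proof
  assume Q: "weak_cert 0 Q"
  have l: "0 < lead_coeff Q" using weak_cert_lead_coeff_pos[OF Q] .
  show False
  proof (cases "degree Q = 0")
    case True
    then obtain a where "Q = [:a:]" by (rule degree_eq_zeroE)
    then show False using l Q by (simp add: weak_cert_def)
  next
    case False
    have "lead_coeff (pderiv Q) = real (degree Q) * lead_coeff Q"
      using False by (simp add: degree_pderiv coeff_pderiv)
    then have "0 < lead_coeff (pderiv Q)" using l False by simp
    then obtain N where "\<forall>j\<ge>N. 0 < poly (pderiv Q) (real j)" using poly_eventually_pos by blast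
    then have "0 < poly (pderiv Q) (real (max N 1))" by (meson max.cobounded1)
    moreover have "poly (pderiv Q) (real (max N 1)) \<le> 0"
      using Q unfolding weak_cert_def by (metis max.cobounded2 mult_zero_left)
    ultimately show False by simp
  qed
qed

section \<open>Changing the degree of a certificate\<close>

definition cert :: "real \<Rightarrow> real poly \<Rightarrow> bool" where
  "cert c Q \<longleftrightarrow> weak_cert c Q \<and> poly Q 0 = 0"

lemma certD:
  assumes "cert c Q"
  shows "Q \<noteq> 0" "poly Q 0 = 0" "poly (pderiv Q) 0 \<le> 0" "0 < lead_coeff Q"
    "1 \<le> j \<Longrightarrow> 0 \<le> poly Q (real j)"
    "1 \<le> j \<Longrightarrow> poly (pderiv Q) (real j) \<le> c * poly Q (real j)"
  using assms weak_cert_lead_coeff_pos by (auto simp: cert_def weak_cert_def)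

text \<open>Logarithmic derivatives add up. Up to node \<open>a\<close> the new factor decreases,
  which only helps; beyond \<open>a\<close> both \<open>Q\<close> and the factor have logarithmic
  derivative at most \<open>c / 2\<close> where \<open>Q > 0\<close>.\<close>

lemma cert_mult_quadratic:
  assumes Q: "cert c Q" and c: "0 < c"
  shows "\<exists>T. cert c T \<and> degree T = degree Q + 2"
proof -
  have "0 < lead_coeff (smult (c / 2) Q - pderiv Q)"
    by (rule smult_minus_pderiv(2)) (use certD(4)[OF Q] c in simp_all)
  then obtain a where "\<forall>j\<ge>a. 0 < poly (smult (c / 2) Q - pderiv Q) (real j)"
    using poly_eventually_pos by blast
  then have a: "poly (pderiv Q) (real j) \<le> c / 2 * poly Q (real j)" if "j \<ge> a" for j
    using that by (auto intro: less_imp_le)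
  \<comment> \<open>With this value \<open>c / 2 * (u^2 + M) - 2 u\<close> is a multiple of a
    perfect square.\<close>
  define M where "M = 4 / c\<^sup>2"
  have M: "0 < M" using c by (simp add: M_def)
  let ?q = "[:(real a)\<^sup>2 + M, - 2 * real a, 1:]"
  define T where "T = ?q * Q"
  have T: "poly T x = ((x - real a)\<^sup>2 + M) * poly Q x" for x
    by (simp add: T_def algebra_simps power2_eq_square)
  have T': "poly (pderiv T) x = 2 * (x - real a) * poly Q x + ((x - real a)\<^sup>2 + M) * poly (pderiv Q) x" for x
    unfolding T_def pderiv_mult by (simp add: pderiv_pCons algebra_simps power2_eq_square)
  have pos: "0 < (x - real a)\<^sup>2 + M" for x using M by (simp add: add_nonneg_pos)
  have d: "degree T = degree Q + 2"
    unfolding T_def using certD(1)[OF Q] by (subst degree_mult_eq) auto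
  have "poly (pderiv T) (real j) \<le> c * poly T (real j)" if j: "1 \<le> j" for j
  proof (cases "j \<le> a")
    case True
    have "2 * (real j - real a) * poly Q (real j) \<le> 0"
      by (rule mult_nonpos_nonneg) (use True certD(5)[OF Q j] in simp_all)
    moreover have "((real j - real a)\<^sup>2 + M) * poly (pderiv Q) (real j) \<le> ((real j - real a)\<^sup>2 + M) * (c * poly Q (real j))"
      using certD(6)[OF Q j] pos[of "real j"] by (intro mult_left_mono) auto
    ultimately show ?thesis unfolding T T' by (simp add: algebra_simps)
  next
    case False
    define u where "u = real j - real a"
    have "c / 2 * (u\<^sup>2 + M) - 2 * u = c / 2 * (u - 2 / c)\<^sup>2"
      using c by (simp add: M_def field_simps power2_eq_square)
    moreover have "0 \<le> c / 2 * (u - 2 / c)\<^sup>2" using c by simp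
    ultimately have "2 * u \<le> c / 2 * (u\<^sup>2 + M)" by linarith
    then have "2 * u * poly Q (real j) \<le> c / 2 * (u\<^sup>2 + M) * poly Q (real j)"
      using certD(5)[OF Q j] by (rule mult_right_mono)
    moreover have "(u\<^sup>2 + M) * poly (pderiv Q) (real j) \<le> (u\<^sup>2 + M) * (c / 2 * poly Q (real j))"
      using a[of j] False pos[of "real j"] by (intro mult_left_mono) (auto simp: u_def)
    ultimately show ?thesis unfolding T T' u_def[symmetric] by (simp add: algebra_simps)
  qed
  moreover have "poly (pderiv T) 0 \<le> 0"
    unfolding T' using certD(2,3)[OF Q] pos[of 0] by (simp add: mult_nonneg_nonpos)
  moreover have "T \<noteq> 0" using d by auto
  ultimately have "cert c T"
    using certD(2,5)[OF Q] pos by (auto simp: cert_def weak_cert_def T less_imp_le)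
  then show ?thesis using d by blast
qed

text \<open>Dividing by \<open>x - r\<close> lowers the logarithmic derivative by
  \<open>1 / (x - r)\<close>, which is positive at every node because
  \<open>r \<le> 0\<close>.\<close>

lemma cert_divide_root:
  assumes Q: "cert c Q" and e: "Q = [:- r, 1:] * T" and r: "r \<le> 0"
    and T: "poly T 0 = 0" "poly (pderiv T) 0 \<le> 0"
  shows "cert c T"
proof -
  have Qx: "poly Q x = (x - r) * poly T x" for x by (simp add: e algebra_simps)
  have Q': "poly (pderiv Q) x = poly T x + (x - r) * poly (pderiv T) x" for x
    unfolding e pderiv_mult by (simp add: pderiv_pCons algebra_simps)
  have pos: "0 \<le> poly T (real j)" if "1 \<le> j" for j
  proof -
    have "0 < real j - r" using that r by auto
    then show ?thesis using certD(5)[OF Q that] by (simp add: Qx zero_le_mult_iff)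
  qed
  have "poly (pderiv T) (real j) \<le> c * poly T (real j)" if "1 \<le> j" for j
  proof -
    have j: "0 < real j - r" using that r by auto
    have "(real j - r) * poly (pderiv T) (real j) \<le> (real j - r) * (c * poly T (real j))"
      using certD(6)[OF Q that] pos[OF that] unfolding Qx Q' by (simp add: algebra_simps)
    then show ?thesis using j by simp
  qed
  moreover have "T \<noteq> 0" using certD(1)[OF Q] e by auto
  ultimately show ?thesis using T pos by (simp add: cert_def weak_cert_def)
qed

lemma poly_odd_eventually_neg:
  fixes P :: "real poly"
  assumes "odd (degree P)" "0 < lead_coeff P"
  shows "\<exists>x<b. poly P x < 0"
proof -
  let ?R = "- pcompose P [:0, -1:]"
  have "lead_coeff (pcompose P [:0, -1:]) = - lead_coeff P"
    using assms(1) by (subst lead_coeff_comp) auto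
  then have "0 < lead_coeff ?R" using assms(2) by simp
  then obtain n where n: "\<forall>x\<ge>n. lead_coeff ?R \<le> poly ?R x" using poly_pinfty_gt_lc by blast
  let ?x = "max n (1 - b)"
  have "0 < poly ?R ?x" using n \<open>0 < lead_coeff ?R\<close> by (meson less_le_trans max.cobounded1)
  then have "poly P (- ?x) < 0" by (simp add: poly_pcompose)
  moreover have "- ?x < b" by auto
  ultimately show ?thesis by blast
qed

text \<open>For odd degree, a negative root is divided out if there is one. Otherwise
  \<open>Q < 0\<close> on the negative axis, so \<open>T = Q / x\<close> is positive there; together
  with \<open>T(0) = Q'(0) \<le> 0\<close> this gives \<open>T(0) = 0\<close> and then
  \<open>T'(0) \<le> 0\<close>.\<close>

lemma cert_even_degree:
  assumes Q: "cert c Q"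
  shows "\<exists>T. cert c T \<and> even (degree T) \<and> degree T \<le> degree Q"
proof (cases "even (degree Q)")
  case True then show ?thesis using Q by blast
next
  case False
  have deg: "even (degree T) \<and> degree T \<le> degree Q" if "Q = [:- r, 1:] * T" for r T
  proof -
    have "T \<noteq> 0" using certD(1)[OF Q] that by auto
    then have "degree Q = Suc (degree T)" unfolding that by (subst degree_mult_eq) auto
    then show ?thesis using False by auto
  qed
  show ?thesis
  proof (cases "\<exists>r<0. poly Q r = 0")
    case True
    then obtain r where r: "r < 0" "poly Q r = 0" by blast
    then obtain T where T: "Q = [:- r, 1:] * T" by (auto simp: poly_eq_0_iff_dvd dvd_def)
    have T0: "poly T 0 = 0" using certD(2)[OF Q] r(1) by (simp add: T)
    have "poly (pderiv Q) 0 = poly T 0 - r * poly (pderiv T) 0"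
      unfolding T pderiv_mult by (simp add: pderiv_pCons)
    then have "0 \<le> r * poly (pderiv T) 0" using certD(3)[OF Q] T0 by simp
    then have "poly (pderiv T) 0 \<le> 0" using r(1) by (simp add: zero_le_mult_iff)
    then have "cert c T" using cert_divide_root[OF Q T] r(1) T0 by simp
    then show ?thesis using deg[OF T] by blast
  next
    case no_root: False
    have neg: "poly Q x < 0" if x: "x < 0" for x
    proof (rule ccontr)
      assume "\<not> poly Q x < 0"
      then have "0 < poly Q x" using no_root x by force
      moreover obtain y where "y < x" "poly Q y < 0"
        using poly_odd_eventually_neg[OF False certD(4)[OF Q]] by blast
      ultimately obtain z where "z < x" "poly Q z = 0" using poly_IVT_pos[of y x Q] by blast
      then show False using no_root x by force
    qed
    obtain T where T: "Q = [:- 0, 1:] * T" using certD(2)[OF Q] unfolding poly_eq_0_iff_dvd dvd_def by blast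
    have Tpos: "0 < poly T x" if "x < 0" for x
      using neg[OF that] that by (simp add: T mult_less_0_iff)
    have T0_nonneg: "0 \<le> poly T 0"
    proof (rule ccontr)
      assume "\<not> 0 \<le> poly T 0"
      then obtain z where "z < 0" "poly T z = 0"
        using poly_IVT_neg[of "-1" 0 T] Tpos[of "-1"] by force
      then show False using Tpos[of z] by simp
    qed
    have "poly (pderiv Q) 0 = poly T 0"
      unfolding T pderiv_mult by (simp add: pderiv_pCons)
    then have T0: "poly T 0 = 0" using certD(3)[OF Q] T0_nonneg by simp
    have "poly (pderiv T) 0 \<le> 0"
    proof (rule ccontr)
      assume "\<not> poly (pderiv T) 0 \<le> 0"
      then obtain d where d: "d > 0" "\<And>h. 0 < h \<Longrightarrow> h < d \<Longrightarrow> poly T (0 - h) < poly T 0"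
        using DERIV_pos_inc_left[OF poly_DERIV, of T 0] by auto
      show False using d(2)[of "d / 2"] d(1) Tpos[of "- (d / 2)"] T0 by simp
    qed
    then have "cert c T" using cert_divide_root[OF Q T] T0 by simp
    then show ?thesis using deg[OF T] by blast
  qed
qed

lemma cert_degree_eq:
  assumes Q: "cert c Q" "degree Q \<le> p" and c: "0 < c" and p: "even p"
  shows "\<exists>T. cert c T \<and> degree T = p"
proof -
  obtain T0 where T0: "cert c T0" "even (degree T0)" "degree T0 \<le> p"
    using cert_even_degree[OF Q(1)] Q(2) by (meson order_trans)
  have "\<exists>T. cert c T \<and> degree T = degree T0 + 2 * n" for n
  proof (induction n)
    case 0 then show ?case using T0 by auto
  next
    case (Suc n)
    then obtain T where "cert c T" "degree T = degree T0 + 2 * n" by blast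
    then show ?case using cert_mult_quadratic[OF _ c, of T] by fastforce
  qed
  moreover obtain n where "p = degree T0 + 2 * n"
    using T0 p by (metis dvd_diff_nat evenE le_add_diff_inverse)
  ultimately show ?thesis by metis
qed

subsection \<open>Attainment for even order\<close>

lemma power_le_interpolate:
  fixes x L :: real
  assumes "0 \<le> x" "0 < L"
  shows "x ^ n \<le> L ^ n + x ^ Suc n / L"
proof (cases "x \<le> L")
  case True
  then have "x ^ n \<le> L ^ n" using assms by (intro power_mono) auto
  moreover have "0 \<le> x ^ Suc n / L" using assms by simp
  ultimately show ?thesis by linarith
next
  case False
  then have "x ^ n * L \<le> x ^ n * x" using assms by (intro mult_left_mono) auto
  then have "x ^ n \<le> x ^ Suc n / L" using assms by (simp add: pos_le_divide_eq mult.commute)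
  moreover have "0 \<le> L ^ n" using assms by simp
  ultimately show ?thesis by linarith
qed

text \<open>The \<open>p\<close>-th order condition and \<open>c \<beta> \<le> \<alpha>\<close>
  bound the \<open>p\<close>-th moment by \<open>p / c\<close> times the previous one. Interpolating
  at \<open>L = 2 p / c\<close> bounds that by a constant plus half of the \<open>p\<close>-th
  moment, which is absorbed.\<close>

lemma moment_bound:
  assumes o: "lm_order k p \<alpha> \<beta>" and nn: "ssp_nonneg c k \<alpha> \<beta>" and c: "0 < c" and p: "2 \<le> p"
  shows "(\<Sum>j=1..k. \<alpha> j * real j ^ p) \<le> (2 * real p / c) ^ p"
proof -
  define L where "L = 2 * real p / c"
  have L: "0 < L" using c p by (simp add: L_def)
  obtain n where n: "p = Suc n" using p by (cases p) auto
  have pos: "0 \<le> \<alpha> j" "c * \<beta> j \<le> \<alpha> j" if "j \<in> {1..k}" for j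
    using nn that by (auto simp: ssp_nonneg_def)
  let ?M = "\<Sum>j=1..k. \<alpha> j * real j ^ p"
  have a1: "(\<Sum>j=1..k. \<alpha> j) = 1" using o by (simp add: lm_order_def)
  have "lm_functional k \<alpha> \<beta> (monom 1 p) = 0"
    using o p unfolding lm_order_iff_monom by simp
  then have "(\<Sum>j=1..k. real j ^ p * \<alpha> j - real p * real j ^ n * \<beta> j) = 0"
    using p n by (simp add: lm_functional_monom power_0_left)
  then have "?M = (\<Sum>j=1..k. real p * real j ^ n * \<beta> j)"
    by (simp add: sum_subtractf mult.commute[of _ "\<alpha> _"])
  also have "\<dots> \<le> (\<Sum>j=1..k. real p / c * (\<alpha> j * real j ^ n))"
  proof (rule sum_mono)
    fix j assume "j \<in> {1..k}"
    then have "\<beta> j \<le> \<alpha> j / c" using pos(2)[of j] c by (simp add: field_simps)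
    then have "real p * real j ^ n * \<beta> j \<le> real p * real j ^ n * (\<alpha> j / c)"
      by (intro mult_left_mono) auto
    then show "real p * real j ^ n * \<beta> j \<le> real p / c * (\<alpha> j * real j ^ n)"
      by (simp add: mult.commute mult.left_commute)
  qed
  also have "\<dots> \<le> (\<Sum>j=1..k. real p / c * (\<alpha> j * (L ^ n + real j ^ p / L)))"
    using pos(1) c power_le_interpolate[OF _ L, of _ n]
    by (intro sum_mono mult_left_mono) (auto simp: n)
  also have "\<dots> = real p / c * (L ^ n * (\<Sum>j=1..k. \<alpha> j) + ?M / L)"
    by (simp add: sum_distrib_left sum.distrib sum_divide_distrib algebra_simps)
  also have "\<dots> = L ^ p / 2 + ?M / 2"
  proof -
    have "real p / c = L / 2" by (simp add: L_def)
    moreover have "L / 2 * (L ^ n * 1 + M / L) = L ^ Suc n / 2 + M / 2" for M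
      using L by (simp add: field_simps)
    ultimately show ?thesis by (simp only: a1 n[symmetric])
  qed
  finally show ?thesis unfolding L_def by simp
qed

lemma beta_bound:
  assumes o: "lm_order k p \<alpha> \<beta>" and nn: "ssp_nonneg c k \<alpha> \<beta>" and c: "0 < c" and p: "2 \<le> p"
  shows "(\<Sum>j=1..k. \<beta> j * real j ^ p) \<le> (2 * real p / c) ^ p / c"
proof -
  have "c * (\<Sum>j=1..k. \<beta> j * real j ^ p) \<le> (\<Sum>j=1..k. \<alpha> j * real j ^ p)"
    unfolding sum_distrib_left using nn
    by (intro sum_mono) (auto simp: ssp_nonneg_def mult.assoc[symmetric] intro: mult_right_mono)
  also have "\<dots> \<le> (2 * real p / c) ^ p" by (rule moment_bound[OF assms])
  finally show ?thesis using c by (simp add: pos_le_divide_eq mult.commute)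
qed

text \<open>A certificate at \<open>c\<close> tested against a method that is feasible only for some \<open>c0 \<le> c' \<le> c\<close>:
  the slack is controlled by \<open>c - c'\<close>, uniformly in \<open>k\<close>.\<close>

lemma weak_cert_slack:
  assumes Q: "weak_cert c Q" "degree Q \<le> p" and p: "2 \<le> p" and c0: "0 < c0"
  shows "\<exists>B\<ge>0. \<forall>k \<alpha> \<beta> c'. lm_order k p \<alpha> \<beta> \<longrightarrow> ssp_nonneg c' k \<alpha> \<beta> \<longrightarrow> c0 \<le> c' \<longrightarrow> c' \<le> c \<longrightarrow>
    (\<Sum>j=1..k. (\<alpha> j - c' * \<beta> j) * poly Q (real j) +
       \<beta> j * (c * poly Q (real j) - poly (pderiv Q) (real j))) \<le> poly Q 0 + B * (c - c')"
proof -
  obtain C where C: "C \<ge> 0" "\<forall>j\<ge>1. \<bar>poly Q (real j)\<bar> \<le> C * real j ^ p"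
    using poly_le_power[OF Q(2)] by blast
  define B where "B = C * ((2 * real p / c0) ^ p / c0)"
  show ?thesis
  proof (intro exI[of _ B] conjI allI impI)
    show "0 \<le> B" using C c0 by (simp add: B_def)
  next
    fix k \<alpha> \<beta> c'
    assume o: "lm_order k p \<alpha> \<beta>" and nn: "ssp_nonneg c' k \<alpha> \<beta>" and c': "c0 \<le> c'" "c' \<le> c"
    have "(\<Sum>j=1..k. \<beta> j * poly Q (real j)) \<le> (\<Sum>j=1..k. C * (\<beta> j * real j ^ p))"
    proof (rule sum_mono)
      fix j assume j: "j \<in> {1..k}"
      then have "0 \<le> \<beta> j" using nn by (auto simp: ssp_nonneg_def)
      moreover have "poly Q (real j) \<le> C * real j ^ p" using C j by force
      ultimately have "\<beta> j * poly Q (real j) \<le> \<beta> j * (C * real j ^ p)" by (rule mult_left_mono[rotated])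
      then show "\<beta> j * poly Q (real j) \<le> C * (\<beta> j * real j ^ p)" by (simp add: mult.left_commute)
    qed
    also have "\<dots> \<le> B"
      unfolding B_def sum_distrib_left[symmetric]
      by (intro mult_left_mono C beta_bound[OF o ssp_nonneg_antimono[OF nn c'(1)] c0 p])
    finally have b: "(c - c') * (\<Sum>j=1..k. \<beta> j * poly Q (real j)) \<le> (c - c') * B"
      using c' by (intro mult_left_mono) auto
    have "(\<Sum>j=1..k. (\<alpha> j - c' * \<beta> j) * poly Q (real j) +
        \<beta> j * (c' * poly Q (real j) - poly (pderiv Q) (real j))) \<le> poly Q 0"
      using lm_functional_ge[OF nn, of Q] Q o unfolding weak_cert_def lm_order_iff by simp
    moreover have "(\<Sum>j=1..k. (\<alpha> j - c' * \<beta> j) * poly Q (real j) +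
        \<beta> j * (c * poly Q (real j) - poly (pderiv Q) (real j))) =
      (\<Sum>j=1..k. (\<alpha> j - c' * \<beta> j) * poly Q (real j) +
        \<beta> j * (c' * poly Q (real j) - poly (pderiv Q) (real j))) +
      (c - c') * (\<Sum>j=1..k. \<beta> j * poly Q (real j))"
      unfolding sum_distrib_left sum.distrib[symmetric]
      by (rule sum.cong) (auto simp: algebra_simps)
    ultimately show "(\<Sum>j=1..k. (\<alpha> j - c' * \<beta> j) * poly Q (real j) +
       \<beta> j * (c * poly Q (real j) - poly (pderiv Q) (real j))) \<le> poly Q 0 + B * (c - c')"
      using b by (simp add: mult.commute)
  qed
qed

lemma weak_cert_terms_nonneg:
  assumes "weak_cert c Q" "ssp_nonneg c' k \<alpha> \<beta>" "j \<in> {1..k}"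
  shows "0 \<le> (\<alpha> j - c' * \<beta> j) * poly Q (real j)"
    "0 \<le> \<beta> j * (c * poly Q (real j) - poly (pderiv Q) (real j))"
  using assms by (auto simp: weak_cert_def ssp_nonneg_def)

text \<open>At a method feasible for \<open>c - d\<close> the pairing is nonnegative and at most
  \<open>Q(0) + B d\<close>; letting \<open>d\<close> tend to 0 gives
  \<open>Q(0) \<ge> 0\<close>.\<close>

lemma cert_of_weak_cert:
  assumes Q: "weak_cert c Q" "degree Q \<le> p" and p: "2 \<le> p" and c: "0 < c"
    and feas: "\<And>c'. 0 < c' \<Longrightarrow> c' < c \<Longrightarrow> \<exists>k. ssp_feasible k p c'"
  shows "cert c Q"
proof -
  obtain B where B: "B \<ge> 0" "\<And>k \<alpha> \<beta> c'. lm_order k p \<alpha> \<beta> \<Longrightarrow> ssp_nonneg c' k \<alpha> \<beta> \<Longrightarrow> c / 2 \<le> c' \<Longrightarrow> c' \<le> c \<Longrightarrow>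
    (\<Sum>j=1..k. (\<alpha> j - c' * \<beta> j) * poly Q (real j) +
       \<beta> j * (c * poly Q (real j) - poly (pderiv Q) (real j))) \<le> poly Q 0 + B * (c - c')"
    using weak_cert_slack[OF Q p, of "c / 2"] c by auto
  have "0 \<le> poly Q 0"
  proof (rule field_le_epsilon)
    fix e :: real assume e: "0 < e"
    define d where "d = min (c / 2) (e / (1 + B))"
    have d: "0 < d" "d \<le> c / 2" "B * d \<le> e"
    proof -
      show "0 < d" using c e B(1) by (auto simp: d_def)
      show "d \<le> c / 2" unfolding d_def by (rule min.cobounded1)
      have "B * d \<le> B * (e / (1 + B))" using B(1) by (intro mult_left_mono) (auto simp: d_def)
      also have "\<dots> \<le> e" using B(1) e by (simp add: field_simps)
      finally show "B * d \<le> e" .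
    qed
    obtain k \<alpha> \<beta> where m: "lm_order k p \<alpha> \<beta>" "ssp_nonneg (c - d) k \<alpha> \<beta>"
      using feas[of "c - d"] d c unfolding ssp_feasible_def by auto
    have "0 \<le> (\<Sum>j=1..k. (\<alpha> j - (c - d) * \<beta> j) * poly Q (real j) +
       \<beta> j * (c * poly Q (real j) - poly (pderiv Q) (real j)))"
      using weak_cert_terms_nonneg[OF Q(1) m(2)] by (intro sum_nonneg add_nonneg_nonneg)
    also have "\<dots> \<le> poly Q 0 + B * d" using B(2)[OF m] d by simp
    finally show "0 \<le> poly Q 0 + e" using d by simp
  qed
  then show ?thesis using Q(1) by (auto simp: cert_def weak_cert_def)
qed

lemma bounded_subseq_pointwise:
  fixes f :: "nat \<Rightarrow> nat \<Rightarrow> real"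
  assumes "\<And>i n. i < N \<Longrightarrow> \<bar>f n i\<bar> \<le> B"
  shows "\<exists>r l. strict_mono r \<and> (\<forall>i<N. (\<lambda>n. f (r n) i) \<longlonglongrightarrow> l i)"
  using assms
proof (induction N)
  case 0
  then show ?case by (intro exI[of _ id]) (auto simp: strict_mono_def)
next
  case (Suc N)
  then obtain r l where r: "strict_mono r" "\<forall>i<N. (\<lambda>n. f (r n) i) \<longlonglongrightarrow> l i"
    by (metis less_SucI)
  have "bounded (range (\<lambda>n. f (r n) N))"
    using Suc.prems[of N] by (auto simp: bounded_iff)
  then obtain a s where s: "strict_mono s" "((\<lambda>n. f (r n) N) \<circ> s) \<longlonglongrightarrow> a"
    using bounded_imp_convergent_subsequence by blast
  have "(\<lambda>n. f ((r \<circ> s) n) i) \<longlonglongrightarrow> (l(N := a)) i" if "i < Suc N" for i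
  proof (cases "i = N")
    case True then show ?thesis using s(2) by (simp add: o_def)
  next
    case False
    then have "((\<lambda>n. f (r n) i) \<circ> s) \<longlonglongrightarrow> l i"
      using r(2) that by (intro LIMSEQ_subseq_LIMSEQ s(1)) auto
    then show ?thesis using False by (simp add: o_def)
  qed
  then show ?case using strict_mono_o[OF r(1) s(1)] by blast
qed

text \<open>\<open>c Q - Q'\<close> has the same degree as \<open>Q\<close> and a positive leading
  coefficient, so both grow like the full power.\<close>

lemma cert_tail:
  assumes Q: "cert c Q" and c: "0 < c"
  shows "\<exists>\<kappa>>0. \<exists>N\<ge>1. \<forall>j\<ge>N. \<kappa> * real j ^ degree Q \<le> poly Q (real j) \<and>
    \<kappa> * real j ^ degree Q \<le> c * poly Q (real j) - poly (pderiv Q) (real j)"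
proof -
  have l: "0 < lead_coeff Q" using certD(4)[OF Q] .
  obtain a N where a: "a > 0" "\<forall>j\<ge>N. a * real j ^ degree Q \<le> poly Q (real j)"
    using poly_ge_power[OF l] by blast
  let ?R = "smult c Q - pderiv Q"
  obtain b M where b: "b > 0" "\<forall>j\<ge>M. b * real j ^ degree ?R \<le> poly ?R (real j)"
    using poly_ge_power[OF smult_minus_pderiv(2)[OF c l]] by blast
  let ?k = "min a b"
  have *: "?k * real j ^ degree Q \<le> a * real j ^ degree Q"
     "?k * real j ^ degree Q \<le> b * real j ^ degree Q" for j
    by (intro mult_right_mono; simp)+
  have "?k * real j ^ degree Q \<le> poly Q (real j) \<and>
      ?k * real j ^ degree Q \<le> c * poly Q (real j) - poly (pderiv Q) (real j)"
    if "j \<ge> max 1 (max N M)" for j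
  proof -
    have "a * real j ^ degree Q \<le> poly Q (real j)" using a(2) that by simp
    moreover have "b * real j ^ degree Q \<le> c * poly Q (real j) - poly (pderiv Q) (real j)"
      using b(2) that smult_minus_pderiv(1)[OF c l] by simp
    ultimately show ?thesis using *[of j] by linarith
  qed
  then show ?thesis using a(1) b(1) by (intro exI[of _ ?k] conjI exI[of _ "max 1 (max N M)"]) auto
qed

text \<open>As \<open>degree Q = p\<close>, the vanishing slack controls the \<open>p\<close>-th
  moments beyond \<open>N\<close>, so far nodes contribute nothing in the limit to any moment up to
  \<open>p\<close>. Limits of the coefficients at nodes \<open>0\<close> to \<open>N\<close> then
  form a method.\<close>

lemma ssp_feasible_attained:
  assumes Q: "cert c Q" "degree Q = p" and p: "2 \<le> p" and c: "0 < c"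
    and feas: "\<And>c'. 0 < c' \<Longrightarrow> c' < c \<Longrightarrow> \<exists>k. ssp_feasible k p c'"
  shows "\<exists>N. ssp_feasible N p c"
proof -
  have wQ: "weak_cert c Q" using Q by (simp add: cert_def)
  obtain B where B: "B \<ge> 0" "\<And>k \<alpha> \<beta> c'. lm_order k p \<alpha> \<beta> \<Longrightarrow> ssp_nonneg c' k \<alpha> \<beta> \<Longrightarrow> c / 2 \<le> c' \<Longrightarrow> c' \<le> c \<Longrightarrow>
    (\<Sum>j=1..k. (\<alpha> j - c' * \<beta> j) * poly Q (real j) +
       \<beta> j * (c * poly Q (real j) - poly (pderiv Q) (real j))) \<le> B * (c - c')"
    using weak_cert_slack[OF wQ _ p, of "c / 2"] Q c certD(2)[OF Q(1)] by auto
  obtain \<kappa> N where \<kappa>: "\<kappa> > 0" and N: "N \<ge> 1"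
    and tail: "\<And>j. j \<ge> N \<Longrightarrow> \<kappa> * real j ^ p \<le> poly Q (real j)"
       "\<And>j. j \<ge> N \<Longrightarrow> \<kappa> * real j ^ p \<le> c * poly Q (real j) - poly (pderiv Q) (real j)"
    using cert_tail[OF Q(1) c] Q(2) by auto
  define cn where "cn = (\<lambda>n. c - c / (2 * real (Suc n)))"
  have cn: "c / 2 \<le> cn n" "cn n < c" "0 < cn n" for n
  proof -
    have "c / (2 * real (Suc n)) \<le> c / 2" using c by (intro divide_left_mono) auto
    then show "c / 2 \<le> cn n" by (simp add: cn_def)
    then show "0 < cn n" using c by simp
    show "cn n < c" using c by (simp add: cn_def)
  qed
  have cn_lim: "cn \<longlonglongrightarrow> c"
  proof -
    have "(\<lambda>n. c - c / 2 * inverse (real (Suc n))) \<longlonglongrightarrow> c - c / 2 * 0"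
      by (intro tendsto_intros LIMSEQ_inverse_real_of_nat)
    then show ?thesis by (simp add: cn_def[abs_def] field_simps)
  qed
  have "\<exists>k \<alpha> \<beta>. N \<le> k \<and> lm_order k p \<alpha> \<beta> \<and> ssp_nonneg (cn n) k \<alpha> \<beta>" for n
  proof -
    obtain k where "ssp_feasible k p (cn n)" using feas cn by blast
    then have "ssp_feasible (max k N) p (cn n)" by (rule ssp_feasible_mono_steps) simp
    then show ?thesis unfolding ssp_feasible_def by (meson max.cobounded2)
  qed
  then obtain k \<alpha> \<beta> where k: "\<And>n. N \<le> k n" and o: "\<And>n. lm_order (k n) p (\<alpha> n) (\<beta> n)"
    and nn: "\<And>n. ssp_nonneg (cn n) (k n) (\<alpha> n) (\<beta> n)"
    by metis
  have pos: "0 \<le> \<alpha> n j" "0 \<le> \<beta> n j" "cn n * \<beta> n j \<le> \<alpha> n j" if "j \<in> {1..k n}" for n j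
    using nn[of n] that by (auto simp: ssp_nonneg_def)

  \<comment> \<open>The tail mass beyond \<open>N\<close>, in the nonnegative parts
    \<open>\<alpha> - cn \<beta>\<close> and \<open>\<beta>\<close>, weighted with the
    \<open>p\<close>-th power.\<close>
  define t where "t = (\<lambda>n. \<Sum>j\<in>{Suc N..k n}. ((\<alpha> n j - cn n * \<beta> n j) + \<beta> n j) * real j ^ p)"
  have t_nonneg: "0 \<le> t n" for n
    unfolding t_def using pos by (intro sum_nonneg mult_nonneg_nonneg add_nonneg_nonneg) auto
  have t_le: "t n \<le> B / \<kappa> * (c - cn n)" for n
  proof -
    let ?f = "\<lambda>j. (\<alpha> n j - cn n * \<beta> n j) * poly Q (real j) +
       \<beta> n j * (c * poly Q (real j) - poly (pderiv Q) (real j))"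
    have "\<kappa> * t n = (\<Sum>j\<in>{Suc N..k n}. (\<alpha> n j - cn n * \<beta> n j) * (\<kappa> * real j ^ p) + \<beta> n j * (\<kappa> * real j ^ p))"
      unfolding t_def sum_distrib_left by (rule sum.cong) (auto simp: algebra_simps)
    also have "\<dots> \<le> (\<Sum>j\<in>{Suc N..k n}. ?f j)"
      using pos tail by (intro sum_mono add_mono mult_left_mono) auto
    also have "\<dots> \<le> (\<Sum>j\<in>{1..k n}. ?f j)"
      using weak_cert_terms_nonneg[OF wQ nn] by (intro sum_mono2) auto
    also have "\<dots> \<le> B * (c - cn n)"
      using B(2)[OF o nn] cn by (auto intro: less_imp_le)
    finally show ?thesis using \<kappa> by (simp add: field_simps)
  qed
  have t_lim: "t \<longlonglongrightarrow> 0"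
  proof (rule tendsto_sandwich[of "\<lambda>_. 0" _ _ "\<lambda>n. B / \<kappa> * (c - cn n)"])
    have "(\<lambda>n. B / \<kappa> * (c - cn n)) \<longlonglongrightarrow> B / \<kappa> * (c - c)" by (intro tendsto_intros cn_lim)
    then show "(\<lambda>n. B / \<kappa> * (c - cn n)) \<longlonglongrightarrow> 0" by simp
  qed (use t_nonneg t_le in auto)

  \<comment> \<open>The moments of the \<open>n\<close>-th method truncated to the nodes up to
    \<open>N\<close>; the error against the exact moments is bounded by a multiple of
    \<open>t n\<close>.\<close>
  define h where "h = (\<lambda>n m. (\<Sum>j=1..N. \<alpha> n j * poly (monom 1 m) (real j) - \<beta> n j * poly (pderiv (monom 1 m)) (real j))
      - \<beta> n 0 * poly (pderiv (monom 1 m)) 0)"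
  have h_lim: "(\<lambda>n. h n m) \<longlonglongrightarrow> 0 ^ m" if m: "m \<le> p" for m
  proof -
    have bd: "\<bar>h n m - 0 ^ m\<bar> \<le> (1 + c + real p) * t n" for n
    proof -
      let ?g = "\<lambda>j. \<alpha> n j * poly (monom 1 m) (real j) - \<beta> n j * poly (pderiv (monom 1 m)) (real j)"
      have "(\<Sum>j=1..k n. ?g j) = (\<Sum>j=1..N. ?g j) + (\<Sum>j\<in>{Suc N..k n}. ?g j)"
        using sum.ub_add_nat[of 1 N ?g "k n - N"] k[of n] by simp
      then have "0 ^ m = h n m + (\<Sum>j\<in>{Suc N..k n}. ?g j)"
        using o[of n] m unfolding lm_order_iff_monom lm_functional_def h_def by (auto simp: algebra_simps)
      then have "\<bar>h n m - 0 ^ m\<bar> = \<bar>\<Sum>j\<in>{Suc N..k n}. ?g j\<bar>" by simp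
      also have "\<dots> \<le> (\<Sum>j\<in>{Suc N..k n}. \<bar>?g j\<bar>)" by (rule sum_abs)
      also have "\<dots> \<le> (\<Sum>j\<in>{Suc N..k n}. (1 + c + real p) * (((\<alpha> n j - cn n * \<beta> n j) + \<beta> n j) * real j ^ p))"
      proof (rule sum_mono)
        fix j assume j: "j \<in> {Suc N..k n}"
        define d where "d = \<alpha> n j - cn n * \<beta> n j"
        have j1: "1 \<le> real j" "j \<in> {1..k n}" using j N by auto
        have d: "0 \<le> d" "0 \<le> \<beta> n j" using pos[OF j1(2)] by (auto simp: d_def)
        have jm: "real j ^ m \<le> real j ^ p" "real j ^ (m - 1) \<le> real j ^ p"
          using j1 m by (auto intro: power_increasing)
        have "\<bar>?g j\<bar> \<le> \<alpha> n j * real j ^ m + \<beta> n j * (real m * real j ^ (m - 1))"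
          using pos[OF j1(2)] by (simp add: poly_monom pderiv_monom abs_mult order_trans[OF abs_triangle_ineq4])
        also have "\<dots> \<le> \<alpha> n j * real j ^ p + \<beta> n j * (real p * real j ^ p)"
          using pos[OF j1(2)] jm m by (intro add_mono mult_left_mono mult_mono) auto
        also have "\<dots> = (d + (cn n + real p) * \<beta> n j) * real j ^ p"
          by (simp add: d_def algebra_simps)
        also have "\<dots> \<le> ((1 + c + real p) * (d + \<beta> n j)) * real j ^ p"
        proof (rule mult_right_mono)
          have "cn n * \<beta> n j \<le> c * \<beta> n j" using cn(2)[of n] d by (intro mult_right_mono) auto
          then have "0 \<le> c * d + real p * d + \<beta> n j + (c * \<beta> n j - cn n * \<beta> n j)"
            using c d by (intro add_nonneg_nonneg) auto
          also have "\<dots> = (1 + c + real p) * (d + \<beta> n j) - (d + (cn n + real p) * \<beta> n j)"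
            by (simp add: algebra_simps)
          finally show "d + (cn n + real p) * \<beta> n j \<le> (1 + c + real p) * (d + \<beta> n j)"
            by (rule diff_ge_0_iff_ge[THEN iffD1])
        qed simp
        finally show "\<bar>?g j\<bar> \<le> (1 + c + real p) * (((\<alpha> n j - cn n * \<beta> n j) + \<beta> n j) * real j ^ p)"
          by (simp add: d_def mult.assoc)
      qed
      also have "\<dots> = (1 + c + real p) * t n" by (simp add: t_def sum_distrib_left)
      finally show ?thesis .
    qed
    have "(\<lambda>n. (1 + c + real p) * t n) \<longlonglongrightarrow> 0"
      using tendsto_mult_left[OF t_lim, of "1 + c + real p"] by simp
    then have "(\<lambda>n. h n m - 0 ^ m) \<longlonglongrightarrow> 0"
      by (rule Lim_null_comparison[rotated]) (use bd in simp)
    then show ?thesis by (rule LIM_zero_cancel)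
  qed

  have \<alpha>_le: "\<bar>\<alpha> n j\<bar> \<le> 1" if "j \<in> {1..k n}" for n j
  proof -
    have "\<alpha> n j \<le> (\<Sum>j=1..k n. \<alpha> n j)" using pos that by (intro member_le_sum) auto
    then show ?thesis using o[of n] pos that by (simp add: lm_order_def)
  qed
  have \<beta>_le: "\<bar>\<beta> n j\<bar> \<le> 2 / c" if "j \<in> {1..k n}" for n j
  proof -
    have "c / 2 * \<beta> n j \<le> cn n * \<beta> n j" using cn(1) pos that by (intro mult_right_mono) auto
    then have "c / 2 * \<beta> n j \<le> 1" using pos[OF that] \<alpha>_le[OF that] by linarith
    then show ?thesis using c pos[OF that] by (simp add: field_simps)
  qed
  define B0 where "B0 = (2 * real p / (c / 2)) ^ p"
  \<comment> \<open>The first order condition expresses \<open>\<beta> n 0\<close> through the other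
    coefficients, and the \<open>p\<close>-th moment bounds the result.\<close>
  have \<beta>0_le: "\<bar>\<beta> n 0\<bar> \<le> B0" for n
  proof -
    have "(\<Sum>j=1..k n. real j * \<alpha> n j - \<beta> n j) - \<beta> n 0 = 0"
      using o[of n] p unfolding lm_order_def by (elim conjE allE[of _ 1]) simp
    moreover have "(\<Sum>j=1..k n. real j * \<alpha> n j - \<beta> n j) \<le> (\<Sum>j=1..k n. \<alpha> n j * real j ^ p)"
    proof (rule sum_mono)
      fix j assume j: "j \<in> {1..k n}"
      then have "real j ^ 1 \<le> real j ^ p" using p by (intro power_increasing) auto
      then have "\<alpha> n j * real j \<le> \<alpha> n j * real j ^ p" using pos[OF j] by (intro mult_left_mono) auto
      then show "real j * \<alpha> n j - \<beta> n j \<le> \<alpha> n j * real j ^ p" using pos[OF j] by (simp add: mult.commute)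
    qed
    moreover have "\<dots> \<le> B0"
      unfolding B0_def using c cn(1)
      by (intro moment_bound[OF o ssp_nonneg_antimono[OF nn] _ p]) auto
    moreover have "0 \<le> \<beta> n 0" using nn[of n] by (auto simp: ssp_nonneg_def)
    ultimately show ?thesis by simp
  qed
  \<comment> \<open>\<open>\<alpha> n 0\<close> is unconstrained and might be unbounded in
    \<open>n\<close>; it is replaced by 0 before extracting a subsequence.\<close>
  define \<alpha>' where "\<alpha>' = (\<lambda>n j. if j = 0 then 0 else \<alpha> n j)"
  obtain r1 a where r1: "strict_mono r1" "\<And>j. j < Suc N \<Longrightarrow> (\<lambda>n. \<alpha>' (r1 n) j) \<longlonglongrightarrow> a j"
  proof -
    have "\<bar>\<alpha>' n j\<bar> \<le> 1" if "j < Suc N" for n j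
    proof (cases "j = 0")
      case False
      then have "j \<in> {1..k n}" using that k[of n] by auto
      then show ?thesis using \<alpha>_le False by (simp add: \<alpha>'_def)
    qed (simp add: \<alpha>'_def)
    then show thesis using bounded_subseq_pointwise[of "Suc N" \<alpha>' 1] that by metis
  qed
  obtain r2 b where r2: "strict_mono r2" "\<And>j. j < Suc N \<Longrightarrow> (\<lambda>n. \<beta> (r1 (r2 n)) j) \<longlonglongrightarrow> b j"
  proof -
    have "\<bar>\<beta> (r1 n) j\<bar> \<le> max (2 / c) B0" if "j < Suc N" for n j
    proof (cases "j = 0")
      case False
      then have "j \<in> {1..k (r1 n)}" using that k[of "r1 n"] by auto
      then show ?thesis using \<beta>_le by (meson max.coboundedI1)
    qed (use \<beta>0_le in \<open>auto simp: max.coboundedI2\<close>)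
    then show thesis using bounded_subseq_pointwise[of "Suc N" "\<lambda>n j. \<beta> (r1 n) j"] that by metis
  qed
  define r where "r = r1 \<circ> r2"
  have r: "strict_mono r" unfolding r_def by (rule strict_mono_o[OF r1(1) r2(1)])
  have \<beta>_lim: "(\<lambda>n. \<beta> (r n) j) \<longlonglongrightarrow> b j" if "j \<le> N" for j
    using r2(2)[of j] that by (simp add: r_def)
  have \<alpha>_lim: "(\<lambda>n. \<alpha> (r n) j) \<longlonglongrightarrow> a j" if "1 \<le> j" "j \<le> N" for j
    using LIMSEQ_subseq_LIMSEQ[OF r1(2)[of j] r2(1)] that by (simp add: r_def o_def \<alpha>'_def)
  have "lm_functional N a b (monom 1 m) = 0 ^ m" if "m \<le> p" for m
  proof (rule LIMSEQ_unique)
    show "(\<lambda>n. h (r n) m) \<longlonglongrightarrow> lm_functional N a b (monom 1 m)"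
      unfolding h_def lm_functional_def by (intro tendsto_intros \<alpha>_lim \<beta>_lim) auto
    show "(\<lambda>n. h (r n) m) \<longlonglongrightarrow> 0 ^ m"
      using LIMSEQ_subseq_LIMSEQ[OF h_lim[OF that] r] by (simp add: o_def)
  qed
  then have "lm_order N p a b" by (simp add: lm_order_iff_monom)
  moreover have "ssp_nonneg c N a b"
    unfolding ssp_nonneg_def
  proof (intro conjI ballI)
    fix j assume j: "j \<in> {1..N}"
    then have jk: "j \<in> {1..k n}" for n using k[of n] by auto
    have a: "(\<lambda>n. \<alpha> (r n) j) \<longlonglongrightarrow> a j" using \<alpha>_lim j by auto
    show "0 \<le> a j" by (rule LIMSEQ_le_const[OF a]) (use pos(1)[OF jk] in auto)
    have "(\<lambda>n. cn (r n) * \<beta> (r n) j) \<longlonglongrightarrow> c * b j"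
      using LIMSEQ_subseq_LIMSEQ[OF cn_lim r] \<beta>_lim[of j] j by (intro tendsto_mult) (auto simp: o_def)
    then show "c * b j \<le> a j" by (rule LIMSEQ_le[OF _ a]) (use pos(3)[OF jk] in auto)
  next
    fix j assume j: "j \<in> {0..N}"
    then have b: "(\<lambda>n. \<beta> (r n) j) \<longlonglongrightarrow> b j" using \<beta>_lim by auto
    have "0 \<le> \<beta> (r n) j" for n using nn[of "r n"] j k[of "r n"] by (auto simp: ssp_nonneg_def)
    then show "0 \<le> b j" by (intro LIMSEQ_le_const[OF b]) auto
  qed
  ultimately show ?thesis unfolding ssp_feasible_def by blast
qed

subsection \<open>Odd order\<close>

lemma C_imp_inf_real:
  assumes p: "2 \<le> p"
  shows "\<exists>c>0. C_imp_inf p = ereal c \<and> (\<forall>k c'. ssp_feasible k p c' \<longrightarrow> c' \<le> c) \<and>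
    (\<forall>c'. 0 < c' \<longrightarrow> c' < c \<longrightarrow> (\<exists>k. ssp_feasible k p c'))"
proof -
  have le: "C_imp_inf p \<le> 2" unfolding C_imp_inf_eq_SUP by (intro SUP_least C_imp_le_2 p)
  have ge: "C_imp k p \<le> C_imp_inf p" for k unfolding C_imp_inf_eq_SUP by (intro SUP_upper) auto
  have "0 \<le> C_imp_inf p" using ge[of 0] C_imp_nonneg order_trans by blast
  then obtain c where c: "C_imp_inf p = ereal c" "0 \<le> c"
    using le by (cases "C_imp_inf p") auto
  have up: "c' \<le> c" if "ssp_feasible k p c'" for k c'
    using C_imp_ge[OF that] ge[of k] c(1) by (metis ereal_less_eq(3) order_trans)
  have "c \<noteq> 0"
  proof
    assume "c = 0"
    then obtain Q where "weak_cert 0 Q" using weak_cert_exists[of 0 p] up by auto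
    then show False using not_weak_cert_0 by blast
  qed
  moreover have "\<exists>k. ssp_feasible k p c'" if "0 < c'" "c' < c" for c'
  proof -
    have "ereal c' < (SUP k. C_imp k p)" using c that by (simp add: C_imp_inf_eq_SUP[symmetric])
    then obtain k where "ereal c' < C_imp k p" unfolding less_SUP_iff by blast
    then show ?thesis using C_imp_gtD[of c' k p] ssp_feasible_antimono that
      by (meson less_imp_le)
  qed
  ultimately show ?thesis using c up by (intro exI[of _ c]) auto
qed

lemma cert_exists:
  assumes p: "2 \<le> p" and c: "0 < c" and up: "\<And>k c'. ssp_feasible k p c' \<Longrightarrow> c' \<le> c"
    and feas: "\<And>c'. 0 < c' \<Longrightarrow> c' < c \<Longrightarrow> \<exists>k. ssp_feasible k p c'"
    and "even p"
  shows "\<exists>Q. cert c Q \<and> degree Q = p"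
proof -
  obtain Q where "weak_cert c Q" "degree Q \<le> p" using weak_cert_exists[of c p] c up by auto
  then have "cert c Q" using cert_of_weak_cert[OF _ _ p c feas] by blast
  then show ?thesis using cert_degree_eq \<open>degree Q \<le> p\<close> c \<open>even p\<close> by blast
qed

lemma C_imp_eventually_const:
  assumes p: "2 \<le> p" "even p"
  shows "\<exists>K>0. \<forall>k\<ge>K. C_imp k p = C_imp_inf p"
proof -
  obtain c where c: "0 < c" "C_imp_inf p = ereal c"
    and up: "\<And>k c'. ssp_feasible k p c' \<Longrightarrow> c' \<le> c"
    and feas: "\<And>c'. 0 < c' \<Longrightarrow> c' < c \<Longrightarrow> \<exists>k. ssp_feasible k p c'"
    using C_imp_inf_real[OF p(1)] by blast
  have "\<exists>Q. cert c Q \<and> degree Q = p"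
    by (rule cert_exists) (fact p c | erule up | erule (1) feas)+
  then obtain Q where Q: "cert c Q" "degree Q = p" by blast
  obtain N where N: "ssp_feasible N p c" using ssp_feasible_attained[OF Q p(1) c(1) feas] by blast
  have "C_imp k p = C_imp_inf p" if "Suc N \<le> k" for k
  proof (rule antisym)
    show "C_imp k p \<le> C_imp_inf p" unfolding C_imp_inf_eq_SUP by (intro SUP_upper) auto
    show "C_imp_inf p \<le> C_imp k p"
      unfolding c(2) by (intro C_imp_ge ssp_feasible_mono_steps[OF N]) (use that in simp)
  qed
  then show ?thesis by (intro exI[of _ "Suc N"]) auto
qed

text \<open>If all terms of the duality pairing vanish, then so does the pairing with \<open>Q / x^s\<close>,
  where \<open>s\<close> is the order of the root \<open>0\<close>; but this quotient does not vanish at \<open>0\<close>.\<close>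

lemma no_method_on_roots:
  assumes o: "lm_order k p \<alpha> \<beta>" and Q: "cert c Q" "degree Q \<le> p"
    and \<alpha>: "\<And>j. j \<in> {1..k} \<Longrightarrow> \<alpha> j \<noteq> 0 \<Longrightarrow> poly Q (real j) = 0"
    and \<beta>: "\<And>j. j \<in> {1..k} \<Longrightarrow> \<beta> j \<noteq> 0 \<Longrightarrow> poly Q (real j) = 0 \<and> poly (pderiv Q) (real j) = 0"
  shows False
proof -
  define s where "s = order 0 Q"
  obtain R where QR: "Q = [:- 0, 1:] ^ s * R" and R: "\<not> [:- 0, 1:] dvd R"
    using order_decomp[OF certD(1)[OF Q(1)], of 0] unfolding s_def by blast
  have R0: "poly R 0 \<noteq> 0" using R unfolding poly_eq_0_iff_dvd .
  have s: "1 \<le> s"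
    using certD(2)[OF Q(1)] R0 QR by (cases s) auto
  have Rn: "R \<noteq> 0" using R by auto
  have dQ: "degree Q = s + degree R"
    unfolding QR using Rn by (subst degree_mult_eq) (auto simp: degree_power_eq)
  have xs: "[:- 0, 1:] ^ s = (monom 1 s :: real poly)" by (simp add: monom_altdef)
  have Q': "Q = monom 1 s * R" using QR xs by simp
  have root: "poly R (real j) = 0" if "j \<in> {1..k}" "poly Q (real j) = 0" for j
    using that unfolding Q' by (simp add: poly_monom)
  have droot: "poly (pderiv R) (real j) = 0"
    if "j \<in> {1..k}" "poly Q (real j) = 0" "poly (pderiv Q) (real j) = 0" for j
    using that root[OF that(1,2)] unfolding Q' pderiv_mult by (simp add: poly_monom)
  have van: "lm_functional k \<alpha> \<beta> (T * R) = - \<beta> 0 * poly (pderiv (T * R)) 0" for T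
  proof -
    have "\<alpha> j * poly (T * R) (real j) - \<beta> j * poly (pderiv (T * R)) (real j) = 0" if "j \<in> {1..k}" for j
      using \<alpha>[OF that] \<beta>[OF that] root[OF that] droot[OF that]
      unfolding pderiv_mult by (cases "\<alpha> j = 0"; cases "\<beta> j = 0") auto
    then show ?thesis by (simp add: lm_functional_def del: poly_mult)
  qed
  \<comment> \<open>\<open>T = x\<close> isolates \<open>\<beta> 0 * R(0)\<close>, and its degree is
    admissible since \<open>s \<ge> 1\<close>. With \<open>\<beta> 0 = 0\<close> known,
    \<open>T = 1\<close> gives \<open>R(0) = 0\<close>, a contradiction.\<close>
  have "degree ([:0, 1:] * R) \<le> p" using dQ s Q(2) Rn by (subst degree_mult_eq) auto
  then have "\<beta> 0 * poly R 0 = 0"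
    using van[of "[:0, 1:]"] o unfolding lm_order_iff pderiv_mult by (simp add: pderiv_pCons)
  then have "\<beta> 0 = 0" using R0 by simp
  moreover have "degree R \<le> p" using dQ Q(2) by simp
  ultimately show False using van[of 1] o R0 unfolding lm_order_iff by simp
qed

text \<open>The factor \<open>k - x\<close> lowers the logarithmic derivative by
  \<open>1 / (k - x)\<close>, at least \<open>1 / (k - 1)\<close> on the nodes below
  \<open>k\<close>. For larger \<open>c'\<close>, \<open>P\<close> would be a certificate with
  strict derivative condition wherever \<open>Q \<noteq> 0\<close>, leaving only methods supported
  on roots of \<open>Q\<close>.\<close>

lemma ssp_feasible_odd_upper:
  assumes Q: "cert c Q" "degree Q \<le> p" and k: "2 \<le> k" "0 < poly Q (real k)"
    and feas: "ssp_feasible k (Suc p) c'"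
  shows "c' \<le> c - 1 / (real k - 1)"
proof (rule ccontr)
  assume n: "\<not> c' \<le> c - 1 / (real k - 1)"
  obtain \<alpha> \<beta> where o: "lm_order k (Suc p) \<alpha> \<beta>" and nn: "ssp_nonneg c' k \<alpha> \<beta>"
    using feas by (auto simp: ssp_feasible_def)
  have pos: "0 \<le> \<alpha> j" "0 \<le> \<beta> j" "c' * \<beta> j \<le> \<alpha> j" if "j \<in> {1..k}" for j
    using nn that by (auto simp: ssp_nonneg_def)
  have oQ: "lm_functional k \<alpha> \<beta> P = poly P 0" if "degree P \<le> Suc p" for P
    using o that by (simp add: lm_order_iff)
  define P where "P = [:real k, -1:] * Q"
  have P: "poly P x = (real k - x) * poly Q x" for x by (simp add: P_def algebra_simps)
  have P': "poly (pderiv P) x = (real k - x) * poly (pderiv Q) x - poly Q x" for x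
    unfolding P_def pderiv_mult by (simp add: pderiv_pCons algebra_simps)
  have dP: "degree P \<le> Suc p"
    unfolding P_def using certD(1)[OF Q(1)] Q(2) by (subst degree_mult_eq) auto
  have P0: "poly (pderiv P) 0 \<le> 0" "poly P 0 = 0"
    using certD(2,3)[OF Q(1)] by (auto simp: P P' mult_nonneg_nonpos)
  have k1: "0 < real k - 1" using k by simp
  have tP: "0 \<le> c' * poly P (real j) - poly (pderiv P) (real j)"
    "poly Q (real j) \<noteq> 0 \<Longrightarrow> 0 < c' * poly P (real j) - poly (pderiv P) (real j)"
    if j: "j \<in> {1..k}" for j
  proof -
    define q where "q = poly Q (real j)"
    have q: "0 \<le> q" using certD(5)[OF Q(1)] j by (simp add: q_def)
    have "(real k - real j) * poly (pderiv Q) (real j) \<le> (real k - real j) * (c * q)"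
      using certD(6)[OF Q(1), of j] j by (intro mult_left_mono) (auto simp: q_def)
    then have lower: "(c' - c + D) * ((real k - real j) * q) + (1 - (real k - real j) * D) * q
        \<le> c' * poly P (real j) - poly (pderiv P) (real j)" for D
      unfolding P P' q_def[symmetric] by (simp add: algebra_simps)
    define D where "D = 1 / (real k - 1)"
    have D: "0 < D" "0 < c' - c + D" using n k1 by (simp_all add: D_def)
    have e: "1 - (real k - real j) * D = (real j - 1) * D"
      using k1 by (simp add: D_def field_simps)
    have n1: "0 \<le> (c' - c + D) * ((real k - real j) * q)"
      using D j q by (intro mult_nonneg_nonneg) auto
    have n2: "0 \<le> (real j - 1) * D * q"
      using j D q by (intro mult_nonneg_nonneg) auto
    show "0 \<le> c' * poly P (real j) - poly (pderiv P) (real j)"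
      using lower[of D] n1 n2 unfolding e by linarith
    assume "poly Q (real j) \<noteq> 0"
    then have q0: "0 < q" using q by (simp add: q_def)
    show "0 < c' * poly P (real j) - poly (pderiv P) (real j)"
    proof (cases "j = k")
      case True
      then have "0 < (real j - 1) * D * q" using k1 D q0 by simp
      then show ?thesis using lower[of D] n1 unfolding e by linarith
    next
      case False
      have "0 < (c' - c + D) * ((real k - real j) * q)"
        using D j False q0 by (intro mult_pos_pos) auto
      then show ?thesis using lower[of D] n2 unfolding e by linarith
    qed
  qed
  let ?t1 = "\<lambda>j. (\<alpha> j - c' * \<beta> j) * poly P (real j)"
  let ?t2 = "\<lambda>j. \<beta> j * (c' * poly P (real j) - poly (pderiv P) (real j))"
  have "(\<Sum>j=1..k. ?t1 j + ?t2 j) \<le> 0"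
    using lm_functional_ge[OF nn P0(1)] oQ[OF dP] P0 by simp
  moreover have t1: "0 \<le> ?t1 j" and t2: "0 \<le> ?t2 j" if "j \<in> {1..k}" for j
    using pos[OF that] tP(1)[OF that] certD(5)[OF Q(1), of j] that by (auto simp: P)
  ultimately have "(\<Sum>j=1..k. ?t1 j + ?t2 j) = 0" by (intro antisym sum_nonneg add_nonneg_nonneg) auto
  then have z: "?t1 j = 0 \<and> ?t2 j = 0" if "j \<in> {1..k}" for j
    using sum_nonneg_eq_0_iff[of "{1..k}" "\<lambda>j. ?t1 j + ?t2 j"] t1 t2 that
    by (metis (no_types, lifting) add_nonneg_eq_0_iff add_nonneg_nonneg finite_atLeastAtMost)
  have \<beta>Q: "poly Q (real j) = 0" if j: "j \<in> {1..k}" "\<beta> j \<noteq> 0" for j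
    using z[OF j(1)] tP(2)[OF j(1)] j(2) by force
  have \<beta>Q': "poly (pderiv Q) (real j) = 0" if j: "j \<in> {1..k}" "\<beta> j \<noteq> 0" for j
  proof -
    have "j \<noteq> k" using \<beta>Q[OF j] k by auto
    then show ?thesis using z[OF j(1)] \<beta>Q[OF j] j by (simp add: P P')
  qed
  have \<alpha>Q: "poly Q (real j) = 0" if j: "j \<in> {1..k}" "\<alpha> j \<noteq> 0" "j \<noteq> k" for j
  proof (cases "\<beta> j = 0")
    case True
    then show ?thesis using z[OF j(1)] j by (simp add: P)
  qed (use \<beta>Q j in auto)
  have \<beta>k: "\<beta> k = 0" using \<beta>Q[of k] k by auto
  \<comment> \<open>\<open>P(k) = 0\<close>, so \<open>P\<close> gives no information about
    \<open>\<alpha> k\<close>; the pairing with \<open>Q\<close> itself does, as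
    \<open>Q(k) > 0\<close>.\<close>
  have "\<alpha> k = 0"
  proof -
    have "lm_functional k \<alpha> \<beta> Q = 0" using oQ[of Q] Q(2) certD(2)[OF Q(1)] by simp
    then have "(\<Sum>j=1..k. (\<alpha> j - c' * \<beta> j) * poly Q (real j) +
        \<beta> j * (c' * poly Q (real j) - poly (pderiv Q) (real j))) \<le> 0"
      using lm_functional_ge[OF nn certD(3)[OF Q(1)]] by simp
    moreover have "(\<alpha> j - c' * \<beta> j) * poly Q (real j) +
        \<beta> j * (c' * poly Q (real j) - poly (pderiv Q) (real j)) = (if j = k then \<alpha> k * poly Q (real k) else 0)"
      if "j \<in> {1..k}" for j
      using \<alpha>Q[OF that] \<beta>Q[OF that] \<beta>Q'[OF that] \<beta>k
      by (cases "j = k"; cases "\<alpha> j = 0"; cases "\<beta> j = 0") auto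
    ultimately have "(\<Sum>j=1..k. if j = k then \<alpha> k * poly Q (real k) else 0) \<le> 0" by simp
    then have "\<alpha> k * poly Q (real k) \<le> 0" using k by simp
    then show ?thesis using k pos(1)[of k] by (simp add: mult_le_0_iff)
  qed
  have "degree Q \<le> Suc p" using Q(2) by simp
  then show False
    using no_method_on_roots[OF o Q(1)] \<alpha>Q \<beta>Q \<beta>Q' \<open>\<alpha> k = 0\<close> by metis
qed

text \<open>\<open>(a - x) Q\<close> with \<open>a\<close> beyond all nodes still pairs
  nonnegatively. It has degree \<open>q + 1\<close>, leading coefficient
  \<open>- lead_coeff Q\<close> and value 0 at 0, so the pairing equals
  \<open>- lead_coeff Q\<close> times the defect.\<close>

lemma defect_nonpos:
  assumes o: "lm_order k q \<alpha> \<beta>" and nn: "ssp_nonneg c k \<alpha> \<beta>"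
    and Q: "cert c Q" "degree Q = q"
  shows "lm_functional k \<alpha> \<beta> (monom 1 (Suc q)) \<le> 0"
proof -
  define a where "a = real (Suc k)"
  define P where "P = [:a, -1:] * Q"
  have P: "poly P x = (a - x) * poly Q x" for x by (simp add: P_def algebra_simps)
  have P': "poly (pderiv P) x = (a - x) * poly (pderiv Q) x - poly Q x" for x
    unfolding P_def pderiv_mult by (simp add: pderiv_pCons algebra_simps)
  have dP: "degree P \<le> Suc q"
    unfolding P_def using certD(1)[OF Q(1)] Q(2) by (subst degree_mult_eq) auto
  have cP: "coeff P (Suc q) = - lead_coeff Q"
    using Q(2) by (simp add: P_def coeff_eq_0)
  have c0: "coeff P 0 = 0" using certD(2)[OF Q(1)] by (simp add: P poly_0_coeff_0[symmetric])
  have P0: "poly (pderiv P) 0 \<le> 0"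
    using certD(2,3)[OF Q(1)] by (simp add: P' a_def mult_nonneg_nonpos)
  have "0 \<le> (\<Sum>j=1..k. (\<alpha> j - c * \<beta> j) * poly P (real j) +
            \<beta> j * (c * poly P (real j) - poly (pderiv P) (real j)))"
  proof (intro sum_nonneg add_nonneg_nonneg mult_nonneg_nonneg)
    fix j assume j: "j \<in> {1..k}"
    show "0 \<le> \<alpha> j - c * \<beta> j" "0 \<le> \<beta> j" using nn j by (auto simp: ssp_nonneg_def)
    have aj: "0 \<le> a - real j" using j by (simp add: a_def)
    have Qj: "0 \<le> poly Q (real j)" using certD(5)[OF Q(1)] j by simp
    show "0 \<le> poly P (real j)" using aj Qj by (simp add: P)
    have "(a - real j) * poly (pderiv Q) (real j) \<le> (a - real j) * (c * poly Q (real j))"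
      using certD(6)[OF Q(1), of j] j aj by (intro mult_left_mono) auto
    then show "0 \<le> c * poly P (real j) - poly (pderiv P) (real j)"
      using Qj unfolding P P' by (simp add: algebra_simps)
  qed
  also have "\<dots> \<le> lm_functional k \<alpha> \<beta> P" by (rule lm_functional_ge[OF nn P0])
  also have "\<dots> = (\<Sum>m\<le>q. coeff P m * 0 ^ m) - lead_coeff Q * lm_functional k \<alpha> \<beta> (monom 1 (Suc q))"
    unfolding lm_functional_expand[OF dP] using o cP by (simp add: lm_order_iff_monom)
  also have "(\<Sum>m\<le>q. coeff P m * 0 ^ m) = 0"
    by (rule sum.neutral) (use c0 in \<open>auto simp: power_0_left\<close>)
  finally show ?thesis using certD(4)[OF Q(1)] by (simp add: mult_le_0_iff)
qed

section \<open>Raising the order by one with an extra node\<close>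

lemma ratio_tendsto_1: "(\<lambda>k. real k / (real k - a)) \<longlonglongrightarrow> 1"
proof -
  have "filterlim (\<lambda>k. - a + real k) at_top sequentially"
    by (rule filterlim_tendsto_add_at_top[OF tendsto_const filterlim_real_sequentially])
  then have "(\<lambda>k. inverse (- a + real k)) \<longlonglongrightarrow> 0" by (rule tendsto_inverse_0_at_top)
  then have l: "(\<lambda>k. 1 + a * inverse (- a + real k)) \<longlonglongrightarrow> 1 + a * 0" by (intro tendsto_intros)
  obtain N where N: "a < real N" using reals_Archimedean2 by blast
  have "\<forall>\<^sub>F k in sequentially. 1 + a * inverse (- a + real k) = real k / (real k - a)"
    using eventually_ge_at_top[of N]
  proof eventually_elim
    case (elim k)
    then have "a < real k" using N by (meson less_le_trans of_nat_mono)
    then show ?case by (simp add: field_simps)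
  qed
  with l show ?thesis by (simp add: tendsto_cong)
qed

lemma inverse_shift_tendsto_0: "(\<lambda>k. 1 / (real k - a)) \<longlonglongrightarrow> 0"
proof -
  have "filterlim (\<lambda>k. - a + real k) at_top sequentially"
    by (rule filterlim_tendsto_add_at_top[OF tendsto_const filterlim_real_sequentially])
  then have "(\<lambda>k. inverse (- a + real k)) \<longlonglongrightarrow> 0" by (rule tendsto_inverse_0_at_top)
  then show ?thesis by (simp add: inverse_eq_divide)
qed

text \<open>Writing \<open>P = P(k) + (k - x) R\<close> and applying the method of order \<open>q\<close> to \<open>R\<close> yields a
  method of order \<open>q + 1\<close>, with one new node at \<open>k\<close>, up to the normalisation \<open>s\<close>.\<close>

lemma lm_functional_raise_order:
  fixes \<alpha> \<beta> :: "nat \<Rightarrow> real"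
  assumes o: "lm_order K q \<alpha> \<beta>" and k: "K < k" and P: "degree P \<le> Suc q"
  defines "A \<equiv> \<lambda>j. \<alpha> j / (real k - real j) - \<beta> j / (real k - real j)\<^sup>2"
    and "B \<equiv> \<lambda>j. \<beta> j / (real k - real j)"
    and "s \<equiv> 1 / real k + \<beta> 0 / (real k)\<^sup>2"
  shows "lm_functional K A B P + (s - (\<Sum>j=1..K. A j)) * poly P (real k) = s * poly P 0"
proof -
  have k0: "real k > 0" using k by simp
  have "[:- real k, 1:] dvd P - [:poly P (real k):]" by (simp add: poly_eq_0_iff_dvd[symmetric])
  then obtain R' where R': "P - [:poly P (real k):] = [:- real k, 1:] * R'" by (auto simp: dvd_def)
  define R where "R = - R'"
  have PR: "P = [:poly P (real k):] + [:real k, -1:] * R"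
  proof -
    have "P = [:poly P (real k):] + [:- real k, 1:] * R'" using R' by (metis add.commute diff_add_cancel)
    then show ?thesis by (simp add: R_def)
  qed
  have dR: "degree R \<le> q"
  proof (cases "R = 0")
    case False
    have "degree ([:real k, -1:] * R) = Suc (degree R)" using False by (subst degree_mult_eq) auto
    moreover have "degree ([:real k, -1:] * R) \<le> Suc q"
    proof -
      have "[:real k, -1:] * R = P - [:poly P (real k):]" using PR by (metis add_diff_cancel_left')
      then show ?thesis using P by (simp add: degree_diff_le)
    qed
    ultimately show ?thesis by simp
  qed simp
  have Px: "poly P x = poly P (real k) + (real k - x) * poly R x" for x
    by (subst PR) (simp add: algebra_simps)
  have P': "poly (pderiv P) x = (real k - x) * poly (pderiv R) x - poly R x" for x
    by (subst PR) (simp only: pderiv_add pderiv_mult, simp add: pderiv_pCons algebra_simps)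
  have oR: "lm_functional K \<alpha> \<beta> R = poly R 0" using o dR by (simp add: lm_order_iff)
  \<comment> \<open>The correction \<open>- \<beta> j / (k - j)^2\<close> in \<open>A\<close>
    cancels the term \<open>B j * R(j)\<close> produced by differentiating the factor
    \<open>k - x\<close>.\<close>
  have term_eq: "A j * poly P (real j) - B j * poly (pderiv P) (real j) =
      A j * poly P (real k) + (\<alpha> j * poly R (real j) - \<beta> j * poly (pderiv R) (real j))" if "j \<in> {1..K}" for j
  proof -
    define u where "u = real k - real j"
    have u: "u \<noteq> 0" using that k by (auto simp: u_def)
    show ?thesis
      unfolding Px[of "real j"] P' A_def B_def u_def[symmetric] using u
      by (simp add: field_simps power2_eq_square)
  qed
  have "lm_functional K A B P = (\<Sum>j=1..K. A j) * poly P (real k) +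
      (\<Sum>j=1..K. \<alpha> j * poly R (real j) - \<beta> j * poly (pderiv R) (real j)) - B 0 * poly (pderiv P) 0"
    unfolding lm_functional_def using term_eq
    by (simp only: sum.distrib sum_distrib_right cong: sum.cong)
  also have "(\<Sum>j=1..K. \<alpha> j * poly R (real j) - \<beta> j * poly (pderiv R) (real j)) =
      poly R 0 + \<beta> 0 * poly (pderiv R) 0"
    using oR by (simp add: lm_functional_def)
  finally have "lm_functional K A B P + (s - (\<Sum>j=1..K. A j)) * poly P (real k) =
      s * poly P (real k) + poly R 0 + \<beta> 0 * poly (pderiv R) 0 - B 0 * poly (pderiv P) 0"
    by (simp add: algebra_simps)
  also have "\<dots> = s * poly P 0"
    unfolding Px[of 0] P' B_def s_def using k0 by (simp add: field_simps power2_eq_square)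
  finally show ?thesis .
qed

text \<open>Two sign conditions decide. \<open>A - c' B\<close> is
  \<open>\<alpha> - (c' + 1 / (k - j)) \<beta>\<close> up to a positive factor, and
  \<open>1 / (k - j) \<le> 1 / (k - K)\<close>. The weight \<open>E k\<close> of the new node is
  positive for large \<open>k\<close> because the defect is negative.\<close>

lemma ssp_feasible_raise_order:
  assumes o: "lm_order K q \<alpha> \<beta>" and nn: "ssp_nonneg c K \<alpha> \<beta>" and c: "0 < c" and q: "1 \<le> q"
    and neg: "lm_functional K \<alpha> \<beta> (monom 1 (Suc q)) < 0"
  shows "\<forall>\<^sub>F k in sequentially. ssp_feasible k (Suc q) (c - 1 / (real k - real K))"
proof -
  define A where "A = (\<lambda>(k::nat) j. \<alpha> j / (real k - real j) - \<beta> j / (real k - real j)\<^sup>2)"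
  define B where "B = (\<lambda>(k::nat) j. \<beta> j / (real k - real j))"
  define s where "s = (\<lambda>k::nat. 1 / real k + \<beta> 0 / (real k)\<^sup>2)"
  define E where "E = (\<lambda>k. s k - (\<Sum>j=1..K. A k j))"
  define D where "D = lm_functional K \<alpha> \<beta> (monom 1 (Suc q))"
  have \<beta>0: "0 \<le> \<beta> 0" using nn by (auto simp: ssp_nonneg_def)
  have raise: "lm_functional K (A k) (B k) P + E k * poly P (real k) = s k * poly P 0"
    if "K < k" "degree P \<le> Suc q" for k P
    using lm_functional_raise_order[OF o that] by (simp add: A_def B_def E_def s_def)
  \<comment> \<open>\<open>k A\<close> tends to \<open>\<alpha>\<close> and \<open>k B\<close> to
    \<open>\<beta>\<close>, so the rescaled functional tends to the defect \<open>D\<close>.\<close>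
  have lim: "(\<lambda>k. real k * lm_functional K (A k) (B k) (monom 1 (Suc q))) \<longlonglongrightarrow> D"
  proof -
    let ?X = "monom 1 (Suc q) :: real poly"
    have X0: "poly (pderiv ?X) 0 = 0" using q by (simp add: pderiv_monom poly_monom)
    have "(\<lambda>k. \<Sum>j=1..K. (\<alpha> j * (real k / (real k - real j)) -
          \<beta> j * (real k / (real k - real j)) * (1 / (real k - real j))) * poly ?X (real j) -
          \<beta> j * (real k / (real k - real j)) * poly (pderiv ?X) (real j))
       \<longlonglongrightarrow> (\<Sum>j=1..K. (\<alpha> j * 1 - \<beta> j * 1 * 0) * poly ?X (real j) - \<beta> j * 1 * poly (pderiv ?X) (real j))"
      by (intro tendsto_intros ratio_tendsto_1 inverse_shift_tendsto_0)
    moreover have "(\<Sum>j=1..K. (\<alpha> j * (real k / (real k - real j)) -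
          \<beta> j * (real k / (real k - real j)) * (1 / (real k - real j))) * poly ?X (real j) -
          \<beta> j * (real k / (real k - real j)) * poly (pderiv ?X) (real j)) =
        real k * lm_functional K (A k) (B k) ?X" for k
      unfolding lm_functional_def X0 mult_zero_right diff_0_right sum_distrib_left A_def B_def
      by (rule sum.cong) (simp_all add: algebra_simps power2_eq_square)
    moreover have "(\<Sum>j=1..K. (\<alpha> j * 1 - \<beta> j * 1 * 0) * poly ?X (real j) - \<beta> j * 1 * poly (pderiv ?X) (real j)) = D"
      unfolding D_def lm_functional_def X0 by simp
    ultimately show ?thesis by simp
  qed
  have "\<forall>\<^sub>F k in sequentially. real k * lm_functional K (A k) (B k) (monom 1 (Suc q)) < 0"
    by (rule order_tendstoD(2)[OF lim]) (use neg in \<open>simp add: D_def\<close>)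
  moreover have "\<forall>\<^sub>F k in sequentially. 1 / (real k - real K) < c"
    by (rule order_tendstoD(2)[OF inverse_shift_tendsto_0 c])
  ultimately show ?thesis
    using eventually_gt_at_top[of K]
  proof eventually_elim
    case (elim k)
    define c' where "c' = c - 1 / (real k - real K)"
    have c': "0 \<le> c'" using elim by (simp add: c'_def)
    have k0: "0 < real k" using elim by simp
    have s: "0 < s k" using k0 \<beta>0 by (simp add: s_def add_pos_nonneg)
    have "lm_functional K (A k) (B k) (monom 1 (Suc q)) < 0"
      using elim(1) k0 by (simp add: mult_less_0_iff)
    \<comment> \<open>Since the monomial vanishes at 0, \<open>E k * k^(q+1)\<close> is minus the
      negative quantity above.\<close>
    moreover have "lm_functional K (A k) (B k) (monom 1 (Suc q)) + E k * real k ^ Suc q = 0"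
      using raise[of k "monom 1 (Suc q)"] elim by (simp add: degree_monom_eq poly_monom)
    ultimately have "0 < E k * real k ^ Suc q" by linarith
    moreover have "0 < real k ^ Suc q" using k0 by (rule zero_less_power)
    ultimately have E: "0 < E k" by (rule zero_less_mult_pos2)
    define \<alpha>' where "\<alpha>' = (\<lambda>j. if j \<le> K then A k j else if j = k then E k else 0)"
    define \<beta>' where "\<beta>' = (\<lambda>j. if j \<le> K then B k j else 0)"
    have L: "lm_functional k \<alpha>' \<beta>' P = lm_functional K (A k) (B k) P + E k * poly P (real k)" for P
    proof -
      let ?f = "\<lambda>j. \<alpha>' j * poly P (real j) - \<beta>' j * poly (pderiv P) (real j)"
      have "(\<Sum>j=1..k. ?f j) = ?f k + (\<Sum>j\<in>{1..k} - {k}. ?f j)"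
        using elim by (intro sum.remove) auto
      also have "(\<Sum>j\<in>{1..k} - {k}. ?f j) = (\<Sum>j=1..K. ?f j)"
        using elim by (intro sum.mono_neutral_right) (auto simp: \<alpha>'_def \<beta>'_def)
      also have "\<dots> = (\<Sum>j=1..K. A k j * poly P (real j) - B k j * poly (pderiv P) (real j))"
        by (rule sum.cong) (auto simp: \<alpha>'_def \<beta>'_def)
      also have "?f k = E k * poly P (real k)" using elim by (simp add: \<alpha>'_def \<beta>'_def)
      finally show ?thesis by (simp add: lm_functional_def \<beta>'_def)
    qed
    have nn': "ssp_nonneg c' k \<alpha>' \<beta>'"
    proof -
      have B: "0 \<le> B k j" if "j \<le> K" for j
        using nn that elim by (auto simp: B_def ssp_nonneg_def)
      have A: "c' * B k j \<le> A k j" if j: "j \<in> {1..K}" for j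
      proof -
        define u where "u = real k - real j"
        have u: "0 < u" "real k - real K \<le> u" "0 < real k - real K" using j elim by (auto simp: u_def)
        have b: "0 \<le> \<beta> j" "c * \<beta> j \<le> \<alpha> j" using nn j by (auto simp: ssp_nonneg_def)
        have "1 / u \<le> 1 / (real k - real K)" using u by (intro divide_left_mono) auto
        then have "(c' + 1 / u) * \<beta> j \<le> c * \<beta> j" using b by (intro mult_right_mono) (auto simp: c'_def)
        then have "(c' + 1 / u) * \<beta> j / u \<le> \<alpha> j / u" using b u by (intro divide_right_mono) auto
        moreover have "A k j = \<alpha> j / u - 1 / u * \<beta> j / u" "c' * B k j = c' * \<beta> j / u"
          by (simp_all add: A_def B_def u_def power2_eq_square)
        ultimately show ?thesis by (simp only: distrib_right add_divide_distrib)
      qed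
      have A0: "0 \<le> A k j" if j: "j \<in> {1..K}" for j
        using A[OF j] mult_nonneg_nonneg[OF c' B[of j]] j by simp
      show ?thesis
        unfolding ssp_nonneg_def using A A0 B E elim by (auto simp: \<alpha>'_def \<beta>'_def)
    qed
    have "lm_order k (Suc q) (\<lambda>j. 1 / s k * \<alpha>' j) (\<lambda>j. 1 / s k * \<beta>' j)"
      unfolding lm_order_iff lm_functional_scale_coeffs L using raise elim s by simp
    moreover have "ssp_nonneg c' k (\<lambda>j. 1 / s k * \<alpha>' j) (\<lambda>j. 1 / s k * \<beta>' j)"
      by (rule ssp_nonneg_scale[OF nn']) (use s in simp)
    ultimately show ?case unfolding ssp_feasible_def c'_def by blast
  qed
qed

lemma C_imp_odd_gap:
  assumes q: "2 \<le> q" "even q"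
  shows "\<exists>kp>0. \<forall>k>kp.
    ereal (1 / (real k - 1)) \<le> C_imp_inf q - C_imp k (Suc q) \<and>
    C_imp_inf q - C_imp k (Suc q) \<le> ereal (1 / (real k - real kp))"
proof -
  obtain c where c: "0 < c" "C_imp_inf q = ereal c"
    and up: "\<And>k c'. ssp_feasible k q c' \<Longrightarrow> c' \<le> c"
    and feas: "\<And>c'. 0 < c' \<Longrightarrow> c' < c \<Longrightarrow> \<exists>k. ssp_feasible k q c'"
    using C_imp_inf_real[OF q(1)] by blast
  have "\<exists>Q. cert c Q \<and> degree Q = q"
    by (rule cert_exists) (fact q c | erule up | erule (1) feas)+
  then obtain Q where Q: "cert c Q" "degree Q = q" by blast
  obtain K \<alpha> \<beta> where o: "lm_order K q \<alpha> \<beta>" and nn: "ssp_nonneg c K \<alpha> \<beta>"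
    using ssp_feasible_attained[OF Q q(1) c(1) feas] unfolding ssp_feasible_def by blast
  have "\<forall>\<^sub>F k in sequentially. 2 \<le> k \<and> 0 < poly Q (real k)"
    using eventually_conj[OF eventually_ge_at_top[of "2::nat"]]
      poly_eventually_pos[OF certD(4)[OF Q(1)]] unfolding eventually_sequentially[symmetric] by blast
  moreover have "\<forall>\<^sub>F k in sequentially. 1 / (real k - 1) < c"
    by (rule order_tendstoD(2)[OF inverse_shift_tendsto_0 c(1)])
  ultimately have upper: "\<forall>\<^sub>F k in sequentially. C_imp k (Suc q) \<le> ereal (c - 1 / (real k - 1)) \<and> 2 \<le> k"
  proof eventually_elim
    case (elim k)
    have "C_imp k (Suc q) \<le> ereal (c - 1 / (real k - 1))"
    proof (rule C_imp_le)
      fix c' assume f: "ssp_feasible k (Suc q) c'"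
      show "c' \<le> c - 1 / (real k - 1)"
        using ssp_feasible_odd_upper[OF Q(1) _ _ _ f] Q(2) elim by simp
    qed (use elim in simp)
    then show ?case using elim by simp
  qed
  \<comment> \<open>With defect 0 the method would have order \<open>q + 1\<close> and coefficient
    \<open>c\<close> for all larger \<open>k\<close>, contradicting the upper bound just
    shown.\<close>
  have neg: "lm_functional K \<alpha> \<beta> (monom 1 (Suc q)) < 0"
  proof (rule ccontr)
    assume "\<not> ?thesis"
    then have z: "lm_functional K \<alpha> \<beta> (monom 1 (Suc q)) = 0"
      using defect_nonpos[OF o nn Q] by simp
    have "lm_order K (Suc q) \<alpha> \<beta>"
      using o z unfolding lm_order_iff_monom by (auto simp: le_Suc_eq)
    then have f: "ssp_feasible K (Suc q) c" using nn unfolding ssp_feasible_def by blast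
    obtain k where k: "C_imp k (Suc q) \<le> ereal (c - 1 / (real k - 1))" "2 \<le> k" "K \<le> k"
      using eventually_happens[OF eventually_conj[OF upper eventually_ge_at_top[of K]]] by auto
    have "ereal c \<le> C_imp k (Suc q)"
      by (rule C_imp_ge[OF ssp_feasible_mono_steps[OF f k(3)]])
    then have "ereal c \<le> ereal (c - 1 / (real k - 1))" using k(1) by (rule order_trans)
    then have "1 / (real k - 1) \<le> 0" by simp
    then show False using k(2) by (simp add: divide_le_0_iff)
  qed
  have "\<forall>\<^sub>F k in sequentially. ssp_feasible k (Suc q) (c - 1 / (real k - real K))"
    by (rule ssp_feasible_raise_order[OF o nn c(1) _ neg]) (use q in simp)
  with upper obtain M where M: "\<And>k. k \<ge> M \<Longrightarrow> C_imp k (Suc q) \<le> ereal (c - 1 / (real k - 1))"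
      "\<And>k. k \<ge> M \<Longrightarrow> ssp_feasible k (Suc q) (c - 1 / (real k - real K))"
    using eventually_conj unfolding eventually_sequentially by (metis (no_types, lifting) nle_le order_trans)
  \<comment> \<open>Besides covering the thresholds, \<open>kp \<ge> K\<close> allows
    \<open>1 / (k - K)\<close> to be weakened to \<open>1 / (k - kp)\<close>.\<close>
  define kp where "kp = max 1 (max K M)"
  show ?thesis
  proof (intro exI[of _ kp] conjI allI impI)
    show "0 < kp" by (simp add: kp_def)
    fix k assume k: "kp < k"
    have lo: "C_imp k (Suc q) \<le> ereal (c - 1 / (real k - 1))" using M(1) k by (simp add: kp_def)
    have hi: "ereal (c - 1 / (real k - real K)) \<le> C_imp k (Suc q)"
      by (rule C_imp_ge[OF M(2)]) (use k in \<open>simp add: kp_def\<close>)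
    obtain x where x: "C_imp k (Suc q) = ereal x"
      using lo C_imp_nonneg[of k "Suc q"] by (cases "C_imp k (Suc q)") auto
    have "1 / (real k - real K) \<le> 1 / (real k - real kp)"
      using k by (intro divide_left_mono) (auto simp: kp_def)
    then show "ereal (1 / (real k - 1)) \<le> C_imp_inf q - C_imp k (Suc q)"
      "C_imp_inf q - C_imp k (Suc q) \<le> ereal (1 / (real k - real kp))"
      using lo hi unfolding c(2) x by auto
  qed
qed

theorem theorem6p2:
  fixes p :: nat
  assumes "p \<ge> 2"
  shows "(even p \<longrightarrow> (\<exists>K>0. \<forall>k\<ge>K. C_imp k p = C_imp_inf p)) \<and>
         (odd p \<longrightarrow> (\<exists>kp>0. \<forall>k>kp.
            ereal (1 / (real k - 1)) \<le> C_imp_inf (p - 1) - C_imp k p \<and>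
            C_imp_inf (p - 1) - C_imp k p \<le> ereal (1 / (real k - real kp))))"
proof (intro conjI impI)
  assume "even p"
  then show "\<exists>K>0. \<forall>k\<ge>K. C_imp k p = C_imp_inf p" by (rule C_imp_eventually_const[OF assms])
next
  assume p: "odd p"
  then have "p = Suc (p - 1)" "2 \<le> p - 1" "even (p - 1)" using assms by (auto elim: oddE)
  then show "\<exists>kp>0. \<forall>k>kp.
            ereal (1 / (real k - 1)) \<le> C_imp_inf (p - 1) - C_imp k p \<and>
            C_imp_inf (p - 1) - C_imp k p \<le> ereal (1 / (real k - real kp))"
    using C_imp_odd_gap[of "p - 1"] by simp
qed

end
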